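(* Let $0<\mu<2$ and let $(V,Q)\in\mathcal{K}$ with constants $a_0,a,b_0,b$. Then for every $u\in Y_{\mathrm{rad}}$ and every $\alpha>0$ we have $Q(|x|)^{\frac{4}{4-\mu}}(e^{\alpha u^2}-1)\in L^1(\mathbb{R}^2)$. Furthermore, if $0<\alpha<4\pi\left(1+\frac{2b_0}{4-\mu}\right)$, then $$\sup_{u\in Y_{\mathrm{rad}},\ \|u\|\le1}\int_{\mathbb{R}^2}Q(|x|)^{\frac{4}{4-\mu}}(e^{\alpha u^2}-1)\,dx<\infty.$$
   Context: $(V,Q)\in\mathcal{K}$ (with constants $a_0,a,b_0,b$) means: $V\in C(0,\infty)$, $V(r)>0$, and $a_0>-2$, $a>-2$ satisfy $\limsup_{r\to0^+}V(r)/r^{a_0}<\infty$ and $\liminf_{r\to+\infty}V(r)/r^{a}>0$; and $Q\in C(0,\infty)$, $Q(r)>0$, and $b_0>-\frac{4-\mu}{2}$, $b<\frac{a(4-\mu)}{4}$ satisfy $\limsup_{r\to0^+}Q(r)/r^{b_0}<\infty$ and $\limsup_{r\to+\infty}Q(r)/r^{b}<\infty$. $Y:=\{u\in L^2_{\mathrm{loc}}(\mathbb{R}^2): |\nabla u|\in L^2(\mathbb{R}^2),\ \int_{\mathbb{R}^2}V(|x|)u^2\,dx<\infty\}$, with norm $\|u\|^2=\int_{\mathbb{R}^2}(|\nabla u|^2+V(|x|)u^2)\,dx$; $Y_{\mathrm{rad}}$ is the subspace of radial functions in $Y$. *)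

theory Defs
  imports "HOL-Analysis.Analysis"
begin

definition class_K ::
  "real \<Rightarrow> (real \<Rightarrow> real) \<Rightarrow> (real \<Rightarrow> real) \<Rightarrow> real \<Rightarrow> real \<Rightarrow> real \<Rightarrow> real \<Rightarrow> bool"
where
  "class_K \<mu> V Q a\<^sub>0 a b\<^sub>0 b \<longleftrightarrow>
     continuous_on {0<..} V \<and> (\<forall>r>0. V r > 0) \<and> a\<^sub>0 > - 2 \<and> a > - 2 \<and>
     Limsup (at_right 0) (\<lambda>r. ereal (V r / r powr a\<^sub>0)) < \<infinity> \<and>
     Liminf at_top (\<lambda>r. ereal (V r / r powr a)) > 0 \<and>
     continuous_on {0<..} Q \<and> (\<forall>r>0. Q r > 0) \<and> b\<^sub>0 > - ((4 - \<mu>) / 2) \<and> b < a * (4 - \<mu>) / 4 \<and>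
     Limsup (at_right 0) (\<lambda>r. ereal (Q r / r powr b\<^sub>0)) < \<infinity> \<and>
     Limsup at_top (\<lambda>r. ereal (Q r / r powr b)) < \<infinity>"

primrec C_k :: "nat \<Rightarrow> ('a::euclidean_space \<Rightarrow> real) \<Rightarrow> bool" where
  "C_k 0 f \<longleftrightarrow> continuous_on UNIV f"
| "C_k (Suc k) f \<longleftrightarrow> (\<forall>x. f differentiable (at x)) \<and>
     (\<forall>e\<in>Basis. C_k k (\<lambda>x. frechet_derivative f (at x) e))"

definition test_function :: "('a::euclidean_space \<Rightarrow> real) \<Rightarrow> bool" where
  "test_function \<phi> \<longleftrightarrow> (\<forall>k. C_k k \<phi>) \<and> compact (closure {x. \<phi> x \<noteq> 0})"

definition L1_loc :: "('a::euclidean_space \<Rightarrow> 'b::euclidean_space) set" where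
  "L1_loc = {u \<in> borel_measurable lebesgue. \<forall>K. compact K \<longrightarrow> set_integrable lebesgue K u}"

definition L2_loc :: "('a::euclidean_space \<Rightarrow> real) set" where
  "L2_loc = {u \<in> borel_measurable lebesgue.
     \<forall>K. compact K \<longrightarrow> set_integrable lebesgue K (\<lambda>x. (u x)\<^sup>2)}"

definition has_weak_gradient ::
  "('a::euclidean_space \<Rightarrow> real) \<Rightarrow> ('a \<Rightarrow> 'a) \<Rightarrow> bool" where
  "has_weak_gradient u g \<longleftrightarrow> u \<in> L1_loc \<and> g \<in> L1_loc \<and>
     (\<forall>\<phi>. test_function \<phi> \<longrightarrow> (\<forall>e\<in>Basis.
        (LINT x|lebesgue. u x * frechet_derivative \<phi> (at x) e)
          = - (LINT x|lebesgue. (g x \<bullet> e) * \<phi> x)))"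

text \<open>A weak gradient is unique up to null sets, so integrals involving the chosen
  representative below do not depend on the choice. Members of the function spaces are
  honest functions representing their almost-everywhere equivalence classes.\<close>

definition weak_grad :: "('a::euclidean_space \<Rightarrow> real) \<Rightarrow> ('a \<Rightarrow> 'a)" where
  "weak_grad u = (SOME g. has_weak_gradient u g)"

definition space_Y :: "(real \<Rightarrow> real) \<Rightarrow> (real^2 \<Rightarrow> real) set" where
  "space_Y V = {u \<in> L2_loc.
     (\<exists>g. has_weak_gradient u g) \<and>
     integrable lebesgue (\<lambda>x. (norm (weak_grad u x))\<^sup>2) \<and>
     integrable lebesgue (\<lambda>x. V (norm x) * (u x)\<^sup>2)}"

definition norm_Y :: "(real \<Rightarrow> real) \<Rightarrow> (real^2 \<Rightarrow> real) \<Rightarrow> real" where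
  "norm_Y V u =
     sqrt (LINT x|lebesgue. (norm (weak_grad u x))\<^sup>2 + V (norm x) * (u x)\<^sup>2)"

text \<open>Radiality is required almost everywhere, as it is a property of equivalence classes.\<close>

definition space_Y_rad :: "(real \<Rightarrow> real) \<Rightarrow> (real^2 \<Rightarrow> real) set" where
  "space_Y_rad V = {u \<in> space_Y V. \<exists>f. AE x in lebesgue. u x = f (norm x)}"

end

theory Submission
  imports Defs
begin

text \<open>Testing the weak gradient of a radial function \<open>u\<close> with the vector fields
  \<open>\<eta>(|x|\<^sup>2) x / |x|\<^sup>2\<close> and applying the du Bois-Reymond lemma yields a radial representative
  with \<open>|u(x) - u(y)|\<^sup>2 \<le> log(|y| / |x|) / (2 \<pi>) \<integral> |\<nabla>u|\<^sup>2\<close>, where the integral extends over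
  \<open>|x| < |z| \<le> |y|\<close>. Away from the origin this bounds \<open>u\<close>, since \<open>V\<close> controls \<open>u\<close> somewhere in
  every annulus \<open>r < |y| \<le> 2r\<close>, so \<open>exp(\<alpha> u\<^sup>2) - 1\<close> is bounded by a multiple of \<open>u\<^sup>2\<close>, and the power
  of \<open>Q\<close> by a multiple of \<open>V\<close>. Near the origin \<open>u\<^sup>2 \<le> A + \<beta> log(1 / |x|)\<close>, with \<open>\<beta>\<close> as close to
  \<open>1 / (2 \<pi>)\<close> as desired for \<open>u\<close> in the unit ball, and with \<open>\<beta>\<close> arbitrarily small for a single
  \<open>u\<close>. As everything is strictly subcritical, this bound leaves an integrable power of \<open>|x|\<close>
  and Moser's change of variables is not needed.\<close>

section \<open>Smooth functions on the line\<close>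

text \<open>A weak gradient is accessible only through smooth compactly supported functions, so
  concrete ones have to be built. The radial variable is t = |x|^2: unlike |x| it is smooth at the
  origin, and it pushes planar Lebesgue measure forward to pi dt on [0, \<infinity>), without a
  Jacobian. The profile of u is an arbitrary function and u is determined only almost everywhere.
  Therefore no Sobolev function on the half-line is formed: the arguments integrate over the plane
  and end with a null set \<open>N\<close> outside which the increment estimate holds for u itself.
  The factor 1 / (2 pi) arises from Cauchy-Schwarz against 1 / |z|: the integral of |z|^(-2) over
  |x| < |z| \<le> |y| is 2 pi log(|y| / |x|), while the increment carries a factor 2 pi. The
  threshold is a condition at the origin. With \<gamma> = 4 b0 / (4 - \<mu>), the power
  |x|^(\<gamma> - \<alpha> \<beta>) is integrable there when \<alpha> \<beta> < \<gamma> + 2, and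
  \<beta> = 1 / (2 pi) turns this into \<alpha> < 4 pi (1 + 2 b0 / (4 - \<mu>)).\<close>

coinductive smooth :: "(real \<Rightarrow> real) \<Rightarrow> bool" where
  smoothI: "(\<And>x. (f has_real_derivative f' x) (at x)) \<Longrightarrow> smooth f' \<Longrightarrow> smooth f"

lemma smooth_derivE:
  assumes "smooth f"
  obtains f' where "\<And>x. (f has_real_derivative f' x) (at x)" "smooth f'"
  using assms by (metis smooth.cases)

lemma smooth_continuous: "smooth f \<Longrightarrow> continuous_on A f"
  by (meson DERIV_isCont continuous_at_imp_continuous_on smooth_derivE)

text \<open>Infinite differentiability is a greatest fixed point, so it suffices to exhibit a class
  of functions closed under taking derivatives. Most smoothness proofs below consist in choosing
  such a class.\<close>

lemma smooth_coinduct: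
  assumes "P f" and step: "\<And>f. P f \<Longrightarrow> \<exists>f'. (\<forall>x. (f has_real_derivative f' x) (at x)) \<and> P f'"
  shows "smooth f"
  using assms(1)
proof (coinduction arbitrary: f rule: smooth.coinduct)
  case smooth
  from step[OF this] obtain f' where f': "\<forall>x. (f has_real_derivative f' x) (at x)" "P f'"
    by (elim exE conjE)
  show ?case
    apply (rule exI[of _ f], rule exI[of _ f'])
    using f' by simp
qed

lemma smooth_const: "smooth (\<lambda>x. c)"
  by (rule smooth_coinduct[of "\<lambda>f. \<exists>c. f = (\<lambda>x. c)"]) (force intro: exI[of _ "\<lambda>x. 0"])+

lemma smooth_id: "smooth (\<lambda>x. x)"
  by (rule smoothI[of _ "\<lambda>x. 1"]) (auto intro!: smooth_const derivative_eq_intros)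

text \<open>The derivative of a product is a sum of two products, so products alone are not closed
  under differentiation; the algebra generated by the smooth functions is, and coinduction applies
  to it.\<close>

inductive smooth_alg :: "(real \<Rightarrow> real) \<Rightarrow> bool" where
  base: "smooth f \<Longrightarrow> smooth_alg f"
| add: "smooth_alg f \<Longrightarrow> smooth_alg g \<Longrightarrow> smooth_alg (\<lambda>x. f x + g x)"
| mult: "smooth_alg f \<Longrightarrow> smooth_alg g \<Longrightarrow> smooth_alg (\<lambda>x. f x * g x)"

lemma smooth_alg_deriv:
  "smooth_alg f \<Longrightarrow> \<exists>f'. (\<forall>x. (f has_real_derivative f' x) (at x)) \<and> smooth_alg f'"
proof (induction rule: smooth_alg.induct)
  case (base f)
  then show ?case by (meson smooth_derivE smooth_alg.base)
next
  case (add f g)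
  then obtain f' g' where *: "\<forall>x. (f has_real_derivative f' x) (at x)" "smooth_alg f'"
    "\<forall>x. (g has_real_derivative g' x) (at x)" "smooth_alg g'" by blast
  have "\<forall>x. ((\<lambda>x. f x + g x) has_real_derivative f' x + g' x) (at x)"
    using * by (auto intro: DERIV_add)
  moreover have "smooth_alg (\<lambda>x. f' x + g' x)"
    by (rule smooth_alg.add) fact+
  ultimately show ?case by - (rule exI[of _ "\<lambda>x. f' x + g' x"], rule conjI)
next
  case (mult f g)
  then obtain f' g' where *: "\<forall>x. (f has_real_derivative f' x) (at x)" "smooth_alg f'"
    "\<forall>x. (g has_real_derivative g' x) (at x)" "smooth_alg g'" by blast
  have "\<forall>x. ((\<lambda>x. f x * g x) has_real_derivative f x * g' x + f' x * g x) (at x)"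
    using * by (auto intro: DERIV_mult')
  moreover have "smooth_alg (\<lambda>x. f x * g' x + f' x * g x)"
    by (rule smooth_alg.add; rule smooth_alg.mult) fact+
  ultimately show ?case by - (rule exI[of _ "\<lambda>x. f x * g' x + f' x * g x"], rule conjI)
qed

lemma smooth_alg_smooth: "smooth_alg f \<Longrightarrow> smooth f"
  by (rule smooth_coinduct[of smooth_alg, OF _ smooth_alg_deriv])

lemma smooth_add: "smooth f \<Longrightarrow> smooth g \<Longrightarrow> smooth (\<lambda>x. f x + g x)"
  by (rule smooth_alg_smooth, rule smooth_alg.add; rule smooth_alg.base)

lemma smooth_mult: "smooth f \<Longrightarrow> smooth g \<Longrightarrow> smooth (\<lambda>x. f x * g x)"
  by (rule smooth_alg_smooth, rule smooth_alg.mult; rule smooth_alg.base)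

lemma smooth_cmult: "smooth f \<Longrightarrow> smooth (\<lambda>x. c * f x)"
  by (rule smooth_mult[OF smooth_const])

lemma smooth_diff: "smooth f \<Longrightarrow> smooth g \<Longrightarrow> smooth (\<lambda>x. f x - g x)"
  using smooth_add[OF _ smooth_cmult[of g "-1"], of f] by simp

lemma smooth_affine: "smooth f \<Longrightarrow> smooth (\<lambda>x. f (d * x + e))"
proof -
  assume "smooth f"
  \<comment> \<open>The coefficient \<open>c\<close> absorbs the factor \<open>d\<close> that the
    chain rule produces at every derivative.\<close>
  then have "\<exists>c g. smooth g \<and> (\<lambda>x. f (d * x + e)) = (\<lambda>x. c * g (d * x + e))"
    by (intro exI[of _ 1]) auto
  then show ?thesis
  proof (rule smooth_coinduct[of "\<lambda>h. \<exists>c g. smooth g \<and> h = (\<lambda>x. c * g (d * x + e))"])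
    fix h assume "\<exists>c g. smooth g \<and> h = (\<lambda>x. c * g (d * x + e))"
    then obtain c g where g: "smooth g" and h: "h = (\<lambda>x. c * g (d * x + e))" by blast
    from g obtain g' where g': "\<And>x. (g has_real_derivative g' x) (at x)" "smooth g'"
      by (rule smooth_derivE) blast
    have "((\<lambda>x. c * g (d * x + e)) has_real_derivative (c * d) * g' (d * x + e)) (at x)" for x
      by (auto intro!: derivative_eq_intros DERIV_chain'[OF _ g'(1)])
    with g' h show "\<exists>f'. (\<forall>x. (h has_real_derivative f' x) (at x)) \<and>
      (\<exists>c g. smooth g \<and> f' = (\<lambda>x. c * g (d * x + e)))"
      by (intro exI[of _ "\<lambda>x. (c * d) * g' (d * x + e)"]) blast
  qed
qed

text \<open>Vanishing on x \<le> p with p > 0 removes the singularity at 0. The class g / x^k is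
  closed under differentiation: the derivative is (x g' - k g) / x^(k+1), and its numerator vanishes
  on the same half-line.\<close>

lemma smooth_divide_id:
  assumes "smooth f" "0 < p" "\<And>x. x \<le> p \<Longrightarrow> f x = 0"
  shows "smooth (\<lambda>x. f x / x)"
proof -
  let ?X = "\<lambda>h. \<exists>g k. smooth g \<and> (\<forall>x\<le>p. g x = 0) \<and> h = (\<lambda>x::real. g x / x ^ k)"
  have "?X (\<lambda>x. f x / x)"
    using assms by (intro exI[of _ f] exI[of _ 1]) auto
  then show ?thesis
  proof (rule smooth_coinduct[of ?X])
    fix h assume "?X h"
    then obtain g k where g: "smooth g" "\<And>x. x \<le> p \<Longrightarrow> g x = 0"
      and h: "h = (\<lambda>x::real. g x / x ^ k)" by blast
    from g obtain g' where g': "\<And>x. (g has_real_derivative g' x) (at x)" "smooth g'"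
      by (blast elim: smooth_derivE)
    let ?d = "\<lambda>x. x * g' x - real k * g x"
    have lt: "g' x = 0" if "x < p" for x
    proof -
      have "((\<lambda>x. 0) has_real_derivative g' x) (at x)"
        by (rule has_field_derivative_transform_within_open[OF g'(1), of "{..<p}"])
           (use that g in auto)
      then show ?thesis using DERIV_unique DERIV_const by blast
    qed
    \<comment> \<open>At the boundary point \<open>p\<close> there need not be a neighbourhood on
      which \<open>g\<close> vanishes; continuity of g' transports the value from the left.\<close>
    have "g' p = 0"
    proof -
      have "isCont g' p" using smooth_continuous[OF g'(2), of UNIV] by (simp add: continuous_on_eq_continuous_at)
      then have "(g' \<longlongrightarrow> g' p) (at_left p)"
        by (simp add: isCont_def filterlim_at_split)
      moreover have "(g' \<longlongrightarrow> 0) (at_left p)"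
        by (rule tendsto_eventually) (simp add: lt eventually_at_filter)
      ultimately show ?thesis
        by (rule tendsto_unique[OF trivial_limit_at_left_real])
    qed
    with lt have z: "?d x = 0" if "x \<le> p" for x
      using that g(2) by (cases "x = p") auto
    have "(h has_real_derivative ?d x / x ^ Suc k) (at x)" for x
    proof (cases "x < p")
      case True
      then have 0: "?d x = 0" using z by simp
      have "((\<lambda>x. 0) has_real_derivative 0) (at x)" by simp
      then have "(h has_real_derivative 0) (at x)"
        by (rule has_field_derivative_transform_within_open[of _ _ _ "{..<p}"])
           (use True g h in auto)
      then show ?thesis using 0 by simp
    next
      case False
      then have "x > 0" using assms(2) by simp
      have "((\<lambda>x. g x / x ^ k) has_real_derivative
          (g' x * x ^ k - g x * (real k * x ^ (k - 1))) / (x ^ k * x ^ k)) (at x)"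
        using \<open>x > 0\<close> by (intro DERIV_divide g'(1)) (auto intro!: derivative_eq_intros)
      also have "(g' x * x ^ k - g x * (real k * x ^ (k - 1))) / (x ^ k * x ^ k) = ?d x / x ^ Suc k"
        using \<open>x > 0\<close> by (cases k) (simp_all add: field_simps)
      finally show ?thesis unfolding h .
    qed
    moreover have "smooth ?d"
      by (intro smooth_diff smooth_mult smooth_id smooth_const g g')
    ultimately show "\<exists>f'. (\<forall>x. (h has_real_derivative f' x) (at x)) \<and> ?X f'" using z
      by (intro exI[of _ "\<lambda>x. ?d x / x ^ Suc k"]) blast
  qed
qed

section \<open>Bump functions built from exp(-1/x)\<close>

definition flat :: "real poly \<Rightarrow> real \<Rightarrow> real" where
  "flat p x = (if x > 0 then poly p (1 / x) * exp (- (1 / x)) else 0)"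

lemma poly_times_exp_minus_tendsto_0: "((\<lambda>y. poly (p :: real poly) y * exp (- y)) \<longlongrightarrow> 0) at_top"
proof (induction p)
  case (pCons c p)
  have "((\<lambda>y. (\<Sum>i\<le>degree (pCons c p). coeff (pCons c p) i * (y ^ i / exp y))) \<longlongrightarrow> 
     (\<Sum>i\<le>degree (pCons c p). coeff (pCons c p) i * 0)) at_top"
    by (intro tendsto_sum tendsto_mult tendsto_const tendsto_power_div_exp_0)
  then show ?case
    by (simp add: poly_altdef exp_minus sum_distrib_right divide_inverse mult.assoc)
qed simp

text \<open>With y = 1/x, differentiating p(y) exp(-y) in x gives y^2 (p - p')(y) exp(-y). The
  polynomial factor thus makes the family closed under differentiation; at 0 the derivative exists
  because exponential decay beats every power of y.\<close>

lemma flat_deriv: "(flat p has_real_derivative flat ([:0,0,1:] * (p - pderiv p)) x) (at x)"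
proof -
  consider "x > 0" | "x < 0" | "x = 0" by linarith
  then show ?thesis
  proof cases
    case 1
    have "((\<lambda>x. poly p (1 / x) * exp (- (1 / x))) has_real_derivative
       flat ([:0,0,1:] * (p - pderiv p)) x) (at x)"
      using 1 by (auto intro!: derivative_eq_intros DERIV_chain'[OF _ poly_DERIV]
         simp: flat_def field_simps power2_eq_square)
    then show ?thesis
      by (rule has_field_derivative_transform_within_open[of _ _ _ "{0<..}"])
         (use 1 in \<open>auto simp: flat_def\<close>)
  next
    case 2
    have "((\<lambda>x. 0) has_real_derivative 0) (at x)" by simp
    then have "(flat p has_real_derivative 0) (at x)"
      by (rule has_field_derivative_transform_within_open[of _ _ _ "{..<0}"])
         (use 2 in \<open>auto simp: flat_def\<close>)
    then show ?thesis using 2 by (simp add: flat_def)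
  next
    case 3
    have "((\<lambda>h. flat p h / h) \<longlongrightarrow> 0) (at 0)"
      unfolding filterlim_at_split
    proof
      show "((\<lambda>h. flat p h / h) \<longlongrightarrow> 0) (at_left 0)"
        by (rule tendsto_eventually) (auto simp: flat_def eventually_at_filter)
      have "((\<lambda>y. poly ([:0,1:] * p) y * exp (- y)) \<longlongrightarrow> 0) at_top"
        by (rule poly_times_exp_minus_tendsto_0)
      then have "((\<lambda>h. poly ([:0,1:] * p) (inverse h) * exp (- inverse h)) \<longlongrightarrow> 0) (at_right 0)"
        by (rule filterlim_compose[OF _ filterlim_inverse_at_top_right])
      then show "((\<lambda>h. flat p h / h) \<longlongrightarrow> 0) (at_right 0)"
        by (rule Lim_transform_eventually)
           (auto simp: flat_def eventually_at_filter field_simps)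
    qed
    then show ?thesis using 3 by (simp add: DERIV_def flat_def)
  qed
qed

lemma smooth_flat: "smooth (flat p)"
  by (rule smooth_coinduct[of "\<lambda>f. \<exists>p. f = flat p"]) (use flat_deriv in blast)+

text \<open>The factor \<open>n\<close> steepens both edges without enlarging the support: exp(-1 /
  (n c)) tends to 1 for c > 0. The bumps therefore converge pointwise to the indicator of the open
  interval and stay below 1, ready for dominated convergence.\<close>

definition bump :: "real \<Rightarrow> real \<Rightarrow> nat \<Rightarrow> real \<Rightarrow> real" where
  "bump p q n x = flat 1 (real n * (x - p)) * flat 1 (real n * (q - x))"

lemma smooth_bump: "smooth (bump p q n)"
proof -
  have "smooth (\<lambda>x. flat 1 (real n * x + real n * (-p)) * flat 1 ((- real n) * x + real n * q))"
    by (intro smooth_mult smooth_affine smooth_flat)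
  moreover have "bump p q n = (\<lambda>x. flat 1 (real n * x + real n * (-p)) * flat 1 ((- real n) * x + real n * q))"
    by (auto simp: bump_def fun_eq_iff algebra_simps)
  ultimately show ?thesis by simp
qed

lemma flat_1_bounds: "0 \<le> flat 1 x" "flat 1 x \<le> 1"
  by (auto simp: flat_def)

lemma bump_bounds: "0 \<le> bump p q n x" "bump p q n x \<le> 1"
  by (auto simp: bump_def flat_1_bounds mult_le_one)

lemma bump_zero: "x \<le> p \<or> q \<le> x \<Longrightarrow> bump p q n x = 0"
  by (auto simp: bump_def flat_def zero_less_mult_iff)

lemma bump_tendsto: "(\<lambda>n. bump p q n x) \<longlonglongrightarrow> indicator {p<..<q} x"
proof (cases "p < x \<and> x < q")
  case True
  have "(\<lambda>n. exp (- (1 / (real n * c)))) \<longlonglongrightarrow> exp (- (0 * (1 / c)))" for c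
    using tendsto_mult[OF lim_inverse_n tendsto_const[of "1 / c" sequentially]]
    by (intro tendsto_intros) (simp add: divide_inverse mult_ac)
  from tendsto_mult[OF this[of "x - p"] this[of "q - x"]]
  have "(\<lambda>n. exp (- (1 / (real n * (x - p)))) * exp (- (1 / (real n * (q - x))))) \<longlonglongrightarrow> 1" by simp
  moreover have "\<forall>\<^sub>F n in sequentially. exp (- (1 / (real n * (x - p)))) * exp (- (1 / (real n * (q - x))))
      = bump p q n x"
    using eventually_gt_at_top[of 0] by eventually_elim (use True in \<open>auto simp: bump_def flat_def\<close>)
  ultimately have "(\<lambda>n. bump p q n x) \<longlonglongrightarrow> 1"
    by (rule Lim_transform_eventually)
  then show ?thesis using True by simp
next
  case False
  then have "x \<le> p \<or> q \<le> x" by auto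
  with False show ?thesis by (simp add: bump_zero)
qed

section \<open>Radial test functions and radial integration\<close>

text \<open>The primitive normalised to vanish at \<open>p\<close> is constant beyond
  \<open>q\<close>, and that constant is the integral of \<psi>; mean zero is therefore what gives
  it compact support.\<close>

lemma smooth_antiderivative:
  assumes \<psi>: "smooth \<psi>" and pq: "p \<le> q" and z: "\<And>x. x \<le> p \<or> q \<le> x \<Longrightarrow> \<psi> x = 0"
    and int: "(LINT x|lborel. \<psi> x) = 0"
  obtains \<eta> where "smooth \<eta>" "\<And>x. (\<eta> has_real_derivative \<psi> x) (at x)"
    "\<And>x. x \<le> p \<or> q \<le> x \<Longrightarrow> \<eta> x = 0"
proof -
  have cont: "isCont \<psi> x" for x
    using \<psi> by (meson DERIV_isCont smooth_derivE)
  obtain F where "\<forall>x::real. - \<infinity> < ereal x \<longrightarrow> ereal x < \<infinity> \<longrightarrow> (F has_vector_derivative \<psi> x) (at x)"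
    using einterval_antiderivative[of "-\<infinity>" "\<infinity>" \<psi>] cont by auto
  then have F: "(F has_real_derivative \<psi> x) (at x)" for x
    by (simp add: has_real_derivative_iff_has_vector_derivative)
  have const: "F x = F y" if "x \<le> y" "\<And>t. x \<le> t \<Longrightarrow> t \<le> y \<Longrightarrow> \<psi> t = 0" for x y
  proof (cases "x = y")
    case False
    have "F y = F x"
    proof (rule DERIV_isconst_end[of x y F])
      show "x < y" using that False by simp
      show "continuous_on {x..y} F"
        using F by (meson DERIV_isCont continuous_at_imp_continuous_on)
      show "(F has_real_derivative 0) (at t)" if "x < t" "t < y" for t
        using F[of t] that \<open>\<And>t. x \<le> t \<Longrightarrow> t \<le> y \<Longrightarrow> \<psi> t = 0\<close> by simp
    qed
    then show ?thesis by simp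
  qed simp
  have "(LINT x|lborel. \<psi> x * indicator {p..q} x) = F q - F p"
    by (rule integral_FTC_Icc_real) (use pq F cont in auto)
  also have "(\<lambda>x. \<psi> x * indicator {p..q} x) = \<psi>"
  proof
    fix x show "\<psi> x * indicator {p..q} x = \<psi> x"
      using z[of x] by (cases "p \<le> x \<and> x \<le> q") auto
  qed
  finally have qp: "F q = F p" using int by simp
  show ?thesis
  proof (rule that[of "\<lambda>x. F x - F p"])
    show d: "((\<lambda>x. F x - F p) has_real_derivative \<psi> x) (at x)" for x
      using F[of x] by (auto intro!: derivative_eq_intros)
    show "smooth (\<lambda>x. F x - F p)"
      by (rule smoothI[OF d \<psi>])
    show "F x - F p = 0" if "x \<le> p \<or> q \<le> x" for x
      using that const[of x p] const[of q x] z qp by auto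
  qed
qed

lemma integral_deriv_atLeast:
  assumes d: "\<And>x. (\<eta> has_real_derivative \<psi> x) (at x)" and \<psi>: "continuous_on UNIV \<psi>"
    and z: "\<And>x. q \<le> x \<Longrightarrow> \<eta> x = 0" "\<And>x. q \<le> x \<Longrightarrow> \<psi> x = 0"
  shows "(LINT x|lborel. indicator {t..} x * \<psi> x) = - \<eta> t"
proof -
  \<comment> \<open>The upper end \<open>max t q\<close> lies where \<eta> vanishes, and the
    interval degenerates to a point when \<open>t\<close> is already beyond
    \<open>q\<close>.\<close>
  have "(LINT x|lborel. \<psi> x * indicator {t..max t q} x) = \<eta> (max t q) - \<eta> t"
    by (rule integral_FTC_Icc_real) (use d \<psi> in \<open>auto simp: continuous_on_eq_continuous_at\<close>)
  also have "(\<lambda>x. \<psi> x * indicator {t..max t q} x) = (\<lambda>x. indicator {t..} x * \<psi> x)"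
    using z(2) by (auto simp: fun_eq_iff indicator_def)
  finally show ?thesis using z(1)[of "max t q"] by simp
qed

section \<open>Smooth functions of several variables generated by the squared norm and linear
  forms\<close>

inductive smooth_fun :: "('a::euclidean_space \<Rightarrow> real) \<Rightarrow> bool" where
  radial: "smooth h \<Longrightarrow> smooth_fun (\<lambda>x. h (x \<bullet> x))"
| coord: "smooth_fun (\<lambda>x. x \<bullet> e)"
| add: "smooth_fun f \<Longrightarrow> smooth_fun g \<Longrightarrow> smooth_fun (\<lambda>x. f x + g x)"
| mult: "smooth_fun f \<Longrightarrow> smooth_fun g \<Longrightarrow> smooth_fun (\<lambda>x. f x * g x)"

lemma smooth_fun_const: "smooth_fun (\<lambda>x. c)"
  by (rule smooth_fun.radial[OF smooth_const])

lemma radial_has_derivative: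
  assumes "\<And>x. (h has_real_derivative h' x) (at x)"
  shows "((\<lambda>x::'a::euclidean_space. h (x \<bullet> x)) has_derivative (\<lambda>v. h' (x \<bullet> x) * (2 * (x \<bullet> v)))) (at x)"
proof -
  have "((\<lambda>x::'a. x \<bullet> x) has_derivative (\<lambda>v. x \<bullet> v + v \<bullet> x)) (at x)"
    by (intro has_derivative_inner has_derivative_ident)
  then have "((\<lambda>x::'a. x \<bullet> x) has_derivative (\<lambda>v. 2 * (x \<bullet> v))) (at x)"
    by (simp add: inner_commute)
  from has_derivative_compose[OF this assms[unfolded has_field_derivative_def]]
  show ?thesis by simp
qed

lemma smooth_fun_deriv:
  "smooth_fun f \<Longrightarrow> \<exists>f'. (\<forall>x. (f has_derivative f' x) (at x)) \<and> (\<forall>e. smooth_fun (\<lambda>x. f' x e))"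
proof (induction rule: smooth_fun.induct)
  case (radial h)
  then obtain h' where h': "\<And>x. (h has_real_derivative h' x) (at x)" "smooth h'"
    by (blast elim: smooth_derivE)
  have "smooth_fun (\<lambda>x::'a. h' (x \<bullet> x) * (2 * (x \<bullet> e)))" for e
    by (rule smooth_fun.mult[OF smooth_fun.radial[OF h'(2)] smooth_fun.mult[OF smooth_fun_const smooth_fun.coord]])
  then show ?case
    using radial_has_derivative[OF h'(1), where 'a='a]
    by - (rule exI[of _ "\<lambda>x v. h' (x \<bullet> x) * (2 * (x \<bullet> v))"], simp)
next
  case (coord e)
  have "((\<lambda>x. x \<bullet> e) has_derivative (\<lambda>v. v \<bullet> e)) (at x)" for x
    using has_derivative_inner_left[OF has_derivative_ident] .
  then show ?case
    by - (rule exI[of _ "\<lambda>x v. v \<bullet> e"], simp add: smooth_fun_const)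
next
  case (add f g)
  then obtain f' g' where *: "\<And>x. (f has_derivative f' x) (at x)" "\<And>e. smooth_fun (\<lambda>x. f' x e)"
    "\<And>x. (g has_derivative g' x) (at x)" "\<And>e. smooth_fun (\<lambda>x. g' x e)" by blast
  have "smooth_fun (\<lambda>x. f' x e + g' x e)" for e
    by (rule smooth_fun.add) (fact *)+
  moreover have "((\<lambda>x. f x + g x) has_derivative (\<lambda>v. f' x v + g' x v)) (at x)" for x
    by (rule has_derivative_add) (fact *)+
  ultimately show ?case
    by - (rule exI[of _ "\<lambda>x v. f' x v + g' x v"], simp)
next
  case (mult f g)
  then obtain f' g' where *: "\<And>x. (f has_derivative f' x) (at x)" "\<And>e. smooth_fun (\<lambda>x. f' x e)"
    "\<And>x. (g has_derivative g' x) (at x)" "\<And>e. smooth_fun (\<lambda>x. g' x e)" by blast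
  have "smooth_fun (\<lambda>x. f x * g' x e + f' x e * g x)" for e
    by (rule smooth_fun.add; rule smooth_fun.mult) (fact * mult.hyps)+
  moreover have "((\<lambda>x. f x * g x) has_derivative (\<lambda>v. f x * g' x v + f' x v * g x)) (at x)" for x
    by (rule has_derivative_mult) (fact *)+
  ultimately show ?case
    by - (rule exI[of _ "\<lambda>x v. f x * g' x v + f' x v * g x"], simp)
qed

text \<open>Partial derivatives of members of the class are again members, so the induction on
  \<open>k\<close> goes through with \<open>f\<close> generalised. This is how the test functions
  meet the iterated condition in \<open>test_function\<close>.\<close>

lemma smooth_fun_C_k: "smooth_fun f \<Longrightarrow> C_k k f"
proof (induction k arbitrary: f)
  case 0
  from smooth_fun_deriv[OF this] obtain f' where "\<And>x. (f has_derivative f' x) (at x)" by blast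
  then have "isCont f x" for x by (rule has_derivative_continuous)
  then show ?case by (simp add: continuous_at_imp_continuous_on)
next
  case (Suc k)
  from smooth_fun_deriv[OF Suc.prems] obtain f' where
    f': "\<And>x. (f has_derivative f' x) (at x)" "\<And>e. smooth_fun (\<lambda>x. f' x e)" by blast
  have "frechet_derivative f (at x) = f' x" for x
    using frechet_derivative_at[OF f'(1)] by simp
  then show ?case
    using Suc.IH[OF f'(2)] f'(1) by (auto simp: differentiable_def)
qed

lemma test_function_radial:
  fixes e :: "'a::euclidean_space"
  assumes "smooth h" "\<And>x. q \<le> x \<Longrightarrow> h x = 0"
  shows "test_function (\<lambda>x. h (x \<bullet> x) * (x \<bullet> e))"
proof -
  have "C_k k (\<lambda>x. h (x \<bullet> x) * (x \<bullet> e))" for k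
    by (intro smooth_fun_C_k smooth_fun.mult smooth_fun.radial smooth_fun.coord assms)
  moreover have "{x. h (x \<bullet> x) * (x \<bullet> e) \<noteq> 0} \<subseteq> cball 0 (sqrt q)"
  proof
    fix x :: 'a assume "x \<in> {x. h (x \<bullet> x) * (x \<bullet> e) \<noteq> 0}"
    then have "x \<bullet> x < q" using assms(2)[of "x \<bullet> x"] by (cases "q \<le> x \<bullet> x") auto
    then show "x \<in> cball 0 (sqrt q)" by (simp add: norm_eq_sqrt_inner)
  qed
  then have "bounded {x. h (x \<bullet> x) * (x \<bullet> e) \<noteq> 0}"
    by (rule bounded_subset[OF bounded_cball])
  ultimately show ?thesis by (simp add: test_function_def)
qed

lemma frechet_derivative_radial:
  fixes e :: "'a::euclidean_space"
  assumes "\<And>x. (h has_real_derivative h' x) (at x)"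
  shows "frechet_derivative (\<lambda>x. h (x \<bullet> x) * (x \<bullet> e)) (at x) v
    = h (x \<bullet> x) * (v \<bullet> e) + 2 * h' (x \<bullet> x) * (x \<bullet> v) * (x \<bullet> e)"
proof -
  have "((\<lambda>x. h (x \<bullet> x) * (x \<bullet> e)) has_derivative
      (\<lambda>v. h (x \<bullet> x) * (v \<bullet> e) + h' (x \<bullet> x) * (2 * (x \<bullet> v)) * (x \<bullet> e))) (at x)"
    by (intro has_derivative_mult radial_has_derivative assms has_derivative_inner_left has_derivative_ident)
  from frechet_derivative_at[OF this, symmetric] show ?thesis by simp
qed

text \<open>The disc |x|^2 \<le> t has area pi t, so the two measures agree on the half-lines, an
  intersection-stable generator of the Borel sets. Linearity in t is the benefit of the squared
  radius: the density is constant on [0, \<infinity>).\<close>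

lemma distr_norm_sq:
  "distr lborel borel (\<lambda>x::real^2. x \<bullet> x) = density lborel (\<lambda>r. ennreal pi * indicator {0..} r)"
  (is "?M = ?N")
proof (rule measure_eqI_generator_eq[of "range atMost" UNIV _ _ "\<lambda>n. {..real n}"])
  show "Int_stable (range (atMost :: real \<Rightarrow> _))"
    by (auto simp: Int_stable_def)
  have eq: "emeasure ?M {..t} = ennreal pi * ennreal t" "emeasure ?N {..t} = ennreal pi * ennreal t" for t
  proof -
    have "emeasure ?M {..t} = emeasure lborel {x::real^2. x \<bullet> x \<le> t}"
      by (subst emeasure_distr) (auto intro!: arg_cong[of _ _ "emeasure lborel"])
    also have "\<dots> = ennreal pi * ennreal t"
    proof (cases "t \<ge> 0")
      case True
      then have "{x::real^2. x \<bullet> x \<le> t} = cball 0 (sqrt t)"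
        by (auto simp: norm_eq_sqrt_inner)
      with True show ?thesis
        by (simp add: emeasure_cball unit_ball_vol_2 ennreal_mult')
    next
      case False
      then have "{x::real^2. x \<bullet> x \<le> t} = {}"
        by (auto dest: order_trans[OF inner_ge_zero])
      with False show ?thesis by (simp add: ennreal_neg)
    qed
    finally show "emeasure ?M {..t} = ennreal pi * ennreal t" .
    have "emeasure ?N {..t} = (\<integral>\<^sup>+r. ennreal pi * indicator {0..t} r \<partial>lborel)"
      by (subst emeasure_density) (auto intro!: nn_integral_cong simp: indicator_def)
    also have "\<dots> = ennreal pi * ennreal t"
      by (cases "t \<ge> 0") (auto simp: nn_integral_cmult ennreal_neg)
    finally show "emeasure ?N {..t} = ennreal pi * ennreal t" .
  qed
  show "emeasure ?M X = emeasure ?N X" if "X \<in> range atMost" for X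
    using that eq by auto
  show "sets ?M = sigma_sets UNIV (range atMost)" "sets ?N = sigma_sets UNIV (range atMost)"
    by (simp_all add: borel_eq_atMost)
  show "emeasure ?M {..real i} \<noteq> \<infinity>" for i
    unfolding eq by (simp add: ennreal_mult_eq_top_iff)
  show "(\<Union>i. {..real i}) = UNIV"
    by (auto simp: real_arch_simple)
qed auto

lemma nn_integral_radial:
  assumes [measurable]: "f \<in> borel_measurable borel"
  shows "(\<integral>\<^sup>+x. f ((x::real^2) \<bullet> x) \<partial>lebesgue) = ennreal pi * (\<integral>\<^sup>+r. f r * indicator {0..} r \<partial>lborel)"
proof -
  have "(\<integral>\<^sup>+x. f ((x::real^2) \<bullet> x) \<partial>lebesgue) = (\<integral>\<^sup>+r. f r \<partial>distr lborel borel (\<lambda>x::real^2. x \<bullet> x))"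
    by (subst nn_integral_distr) (auto simp: nn_integral_completion)
  also have "\<dots> = (\<integral>\<^sup>+r. ennreal pi * indicator {0..} r * f r \<partial>lborel)"
    unfolding distr_norm_sq by (subst nn_integral_density) auto
  also have "\<dots> = ennreal pi * (\<integral>\<^sup>+r. f r * indicator {0..} r \<partial>lborel)"
    by (subst nn_integral_cmult[symmetric]) (auto simp: mult_ac)
  finally show ?thesis .
qed

lemma integral_radial:
  fixes f :: "real \<Rightarrow> real"
  assumes [measurable]: "f \<in> borel_measurable borel"
  shows "(LINT x|lebesgue. f ((x::real^2) \<bullet> x)) = pi * (LINT r|lborel. indicator {0..} r * f r)"
proof -
  have "(LINT x|lebesgue. f ((x::real^2) \<bullet> x)) = (LINT r|distr lborel borel (\<lambda>x::real^2. x \<bullet> x). f r)"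
    by (subst integral_distr) (auto simp: integral_completion)
  also have "distr lborel borel (\<lambda>x::real^2. x \<bullet> x) = density lborel (\<lambda>r. ennreal (pi * indicator {0..} r))"
    unfolding distr_norm_sq by (intro density_cong) (auto simp: indicator_def)
  also have "integral\<^sup>L \<dots> f = (LINT r|lborel. pi * indicator {0..} r * f r)"
    by (subst integral_density) auto
  finally show ?thesis by (simp add: mult.assoc)
qed

section \<open>Radial functions orthogonal to derivatives\<close>

text \<open>The integral of (f - t h)^2 is a nonnegative quadratic in t; its value at the minimum t
  = I / B gives the inequality when B > 0.\<close>

lemma integral_Cauchy_Schwarz:
  fixes f h :: "'a \<Rightarrow> real"
  assumes [measurable]: "f \<in> borel_measurable M" "h \<in> borel_measurable M"
    and f: "integrable M (\<lambda>x. (f x)\<^sup>2)" and h: "integrable M (\<lambda>x. (h x)\<^sup>2)"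
  shows "(LINT x|M. f x * h x)\<^sup>2 \<le> (LINT x|M. (f x)\<^sup>2) * (LINT x|M. (h x)\<^sup>2)"
proof -
  let ?A = "LINT x|M. (f x)\<^sup>2" and ?B = "LINT x|M. (h x)\<^sup>2" and ?I = "LINT x|M. f x * h x"
  have fh: "integrable M (\<lambda>x. f x * h x)"
  proof (rule Bochner_Integration.integrable_bound[OF Bochner_Integration.integrable_add[OF f h]])
    show "AE x in M. norm (f x * h x) \<le> norm ((f x)\<^sup>2 + (h x)\<^sup>2)"
    proof (rule AE_I2)
      fix x
      have "2 * (\<bar>f x\<bar> * \<bar>h x\<bar>) \<le> (f x)\<^sup>2 + (h x)\<^sup>2"
        using sum_squares_bound[of "\<bar>f x\<bar>" "\<bar>h x\<bar>"] by (simp add: mult.assoc)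
      moreover have "0 \<le> \<bar>f x\<bar> * \<bar>h x\<bar>" by simp
      ultimately show "norm (f x * h x) \<le> norm ((f x)\<^sup>2 + (h x)\<^sup>2)"
        unfolding real_norm_def abs_mult by linarith
    qed
  qed simp
  have q: "0 \<le> ?A - 2 * t * ?I + t\<^sup>2 * ?B" for t
  proof -
    have "0 \<le> (LINT x|M. (f x - t * h x)\<^sup>2)" by simp
    also have "(LINT x|M. (f x - t * h x)\<^sup>2)
        = (LINT x|M. ((f x)\<^sup>2 - 2 * t * (f x * h x)) + t\<^sup>2 * (h x)\<^sup>2)"
      by (rule Bochner_Integration.integral_cong) (auto simp: power2_eq_square algebra_simps)
    also have "\<dots> = ?A - 2 * t * ?I + t\<^sup>2 * ?B"
      using f h fh by simp
    finally show ?thesis .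
  qed
  show ?thesis
  proof (cases "?B = 0")
    case True
    have "?I = 0"
    proof (rule ccontr)
      assume "?I \<noteq> 0"
      \<comment> \<open>At this \<open>t\<close> the remaining affine expression
        \<open>?A - 2 * t * ?I\<close> equals -1.\<close>
      then show False using q[of "(?A + 1) / (2 * ?I)"] True by simp
    qed
    then show ?thesis by (simp add: True)
  next
    case False
    moreover have "?B \<ge> 0" by simp
    ultimately have "?B > 0" by linarith
    then show ?thesis using q[of "?I / ?B"]
      by (simp add: field_simps power2_eq_square)
  qed
qed

lemma inner_self_measurable_lebesgue [measurable]:
  "(\<lambda>x::'a::euclidean_space. x \<bullet> x) \<in> borel_measurable lebesgue"
  by (rule measurable_completion) simp

text \<open>The profile \<^term>\<open>k\<close> is not known to be measurable. The set where it is positive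
  contains, up to a null set, a \<open>\<sigma>\<close>-compact set, and the radial hull of the latter is
  the preimage of a Borel set.\<close>

lemma radial_AE_nonpos:
  fixes v :: "'a::euclidean_space \<Rightarrow> real"
  assumes v: "integrable lebesgue v" and k: "AE x in lebesgue. v x = k (x \<bullet> x)"
    and B: "\<And>B. B \<in> sets borel \<Longrightarrow> (LINT x|lebesgue. indicator B (x \<bullet> x) * v x) = 0"
  shows "AE x in lebesgue. v x \<le> 0"
proof -
  have [measurable]: "v \<in> borel_measurable lebesgue" using v by simp
  define E where "E = {x::'a. k (x \<bullet> x) > 0}"
  from k obtain N where N: "N \<in> null_sets lebesgue" "{x. v x \<noteq> k (x \<bullet> x)} \<subseteq> N"
    unfolding eventually_ae_filter by auto
  have Nv: "v x = k (x \<bullet> x)" if "x \<notin> N" for x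
    using that N(2) by blast
  \<comment> \<open>Completeness of Lebesgue measure makes \<open>E\<close> measurable although
    \<open>k\<close> need not be: \<open>E\<close> agrees with the set where v > 0 outside
    \<open>N\<close>.\<close>
  have "E = ({x \<in> space lebesgue. v x > 0} - N) \<union> (E \<inter> N)"
    using Nv by (auto simp: E_def) (metis | fastforce)+
  moreover have "{x \<in> space lebesgue. v x > 0} \<in> sets lebesgue" by measurable
  moreover have "E \<inter> N \<in> null_sets lebesgue"
    using null_sets_completion_subset[of "E \<inter> N" N lborel] N(1) by auto
  ultimately have "E \<in> sets lebesgue"
    using N(1) by (metis null_setsD2 sets.Diff sets.Un)
  then obtain C T where C: "fsigma C" and T: "T \<in> null_sets lebesgue" "C \<union> T = E"
    by (rule lebesgue_set_almost_fsigma)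
  obtain F :: "nat \<Rightarrow> 'a set" where F: "range F \<subseteq> Collect compact" "C = \<Union>(range F)"
    using C by (auto simp: fsigma_Union_compact)
  define B where "B = (\<Union>i. (\<lambda>x. x \<bullet> x) ` F i)"
  have "compact ((\<lambda>x. x \<bullet> x) ` F i)" for i
    using F by (intro compact_continuous_image continuous_intros) auto
  then have [measurable]: "B \<in> sets borel"
    unfolding B_def by (intro sets.countable_UN') (auto intro!: borel_compact)
  have m: "(\<lambda>x. indicator B (x \<bullet> x) * v x) \<in> borel_measurable lebesgue"
    by measurable
  have "(LINT x|lebesgue. indicator B (x \<bullet> x) * v x) = 0"
    by (rule assms(3)) fact
  moreover have "(LINT x|lebesgue. indicator B (x \<bullet> x) * v x) = (LINT x|lebesgue. max 0 (v x))"
  proof (rule integral_cong_AE)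
    show "AE x in lebesgue. indicator B (x \<bullet> x) * v x = max 0 (v x)"
      using k AE_not_in[OF T(1)]
    proof eventually_elim
      fix x assume x: "v x = k (x \<bullet> x)" "x \<notin> T"
      have "x \<bullet> x \<in> B" if "x \<in> E"
        using that x T(2) F(2) by (auto simp: B_def)
      \<comment> \<open>\<open>E\<close> is radial, so passing from \<open>C\<close> to its radial
        hull does not leave \<open>E\<close>.\<close>
      moreover have "x \<in> E" if "x \<bullet> x \<in> B"
      proof -
        from that obtain y where "y \<in> C" "x \<bullet> x = y \<bullet> y" using F(2) by (auto simp: B_def)
        then show ?thesis using T(2) by (auto simp: E_def)
      qed
      ultimately have "x \<bullet> x \<in> B \<longleftrightarrow> v x > 0" using x by (auto simp: E_def)
      then show "indicator B (x \<bullet> x) * v x = max 0 (v x)" by (auto simp: indicator_def)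
    qed
  qed (use m in auto)
  ultimately have "(LINT x|lebesgue. max 0 (v x)) = 0" by simp
  moreover have "integrable lebesgue (\<lambda>x. max 0 (v x))" using v by auto
  ultimately have "AE x in lebesgue. max 0 (v x) = 0"
    by (subst (asm) integral_nonneg_eq_0_iff_AE) auto
  then show ?thesis by eventually_elim (auto simp: max_def split: if_splits)
qed

lemma radial_AE_zero:
  fixes v :: "'a::euclidean_space \<Rightarrow> real"
  assumes v: "integrable lebesgue v" and k: "AE x in lebesgue. v x = k (x \<bullet> x)"
    and B: "\<And>B. B \<in> sets borel \<Longrightarrow> (LINT x|lebesgue. indicator B (x \<bullet> x) * v x) = 0"
  shows "AE x in lebesgue. v x = 0"
proof -
  have "AE x in lebesgue. v x \<le> 0"
    by (rule radial_AE_nonpos) fact+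
  moreover have "AE x in lebesgue. - v x \<le> 0"
  proof (rule radial_AE_nonpos[of "\<lambda>x. - v x" "\<lambda>r. - k r"])
    show "AE x in lebesgue. - v x = - k (x \<bullet> x)" using k by eventually_elim simp
  qed (use v B in auto)
  ultimately show ?thesis by eventually_elim simp
qed

text \<open>Open intervals generate the Borel sets and are stable under intersection, so a pi-lambda
  argument applies. The support condition identifies the integral of \<open>v\<close> over the plane
  with that over one interval, which settles complements.\<close>

lemma integral_Borel_from_intervals:
  fixes v :: "'a::euclidean_space \<Rightarrow> real"
  assumes v: "integrable lebesgue v" and supp: "\<And>x. x \<bullet> x \<notin> {p<..<q} \<Longrightarrow> v x = 0"
    and I: "\<And>r s. (LINT x|lebesgue. indicator {r<..<s} (x \<bullet> x) * v x) = 0"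
    and B: "B \<in> sets borel"
  shows "(LINT x|lebesgue. indicator B (x \<bullet> x) * v x) = 0"
proof -
  have [measurable]: "v \<in> borel_measurable lebesgue" using v by simp
  have int: "integrable lebesgue (\<lambda>x. indicator B (x \<bullet> x) * v x)" if "B \<in> sets borel" for B
  proof (rule Bochner_Integration.integrable_bound[OF v])
    show "(\<lambda>x. indicator B (x \<bullet> x) * v x) \<in> borel_measurable lebesgue"
      using that by measurable
  qed (auto simp: indicator_def)
  have v0: "(LINT x|lebesgue. v x) = 0"
  proof -
    have "(\<lambda>x. indicator {p<..<q} (x \<bullet> x) * v x) = v"
      using supp by (fastforce simp: indicator_def)
    then show ?thesis using I[of p q] by simp
  qed
  let ?G = "range (\<lambda>(a, b). {a<..<b::real})"
  have borel_eq: "(borel :: real measure) = sigma UNIV ?G"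
    unfolding borel_eq_box by (intro arg_cong[of _ _ "sigma UNIV"]) (auto intro!: image_cong)
  have "Int_stable ?G"
    by (auto simp: Int_stable_def)
  moreover have "?G \<subseteq> Pow UNIV" by simp
  moreover have "B \<in> sigma_sets UNIV ?G"
    using B by (simp add: borel_eq)
  ultimately show ?thesis
  proof (induction B rule: sigma_sets_induct_disjoint[where \<Omega> = UNIV and G = ?G])
    case (basic A)
    then show ?case using I by auto
  next
    case (compl A)
    then have A: "A \<in> sets borel" by (simp add: borel_eq)
    have "(LINT x|lebesgue. indicator (UNIV - A) (x \<bullet> x) * v x)
        = (LINT x|lebesgue. v x - indicator A (x \<bullet> x) * v x)"
      by (rule Bochner_Integration.integral_cong) (auto simp: indicator_def)
    also have "\<dots> = 0" using int[OF A] v v0 compl.IH by simp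
    finally show ?case .
  next
    case (union A)
    then have A: "A i \<in> sets borel" for i by (auto simp: borel_eq)
    let ?P = "\<lambda>i. {x \<in> space lebesgue. x \<bullet> x \<in> A i}"
    have "(LINT x:(\<Union>i. ?P i)|lebesgue. v x) = (\<Sum>i. LINT x:?P i|lebesgue. v x)"
    proof (rule lebesgue_integral_countable_add)
      show "?P i \<in> sets lebesgue" for i using A[of i] by measurable
      show "?P i \<inter> ?P j = {}" if "i \<noteq> j" for i j
        using union(1) that by (auto simp: disjoint_family_on_def)
      have "(\<Union>i. ?P i) \<in> sets lebesgue" using A by measurable
      then show "set_integrable lebesgue (\<Union>i. ?P i) v"
        unfolding set_integrable_def by (rule integrable_mult_indicator) (rule v)
    qed
    moreover have "(LINT x:?P i|lebesgue. v x) = 0" for i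
      using union(3)[of i] by (simp add: set_lebesgue_integral_def indicator_def)
    ultimately show ?case
      by (simp add: set_lebesgue_integral_def indicator_def)
  qed auto
qed

section \<open>From bumps to annuli: du Bois-Reymond in the radial variable\<close>

lemma integral_bump_tendsto:
  assumes "integrable M v" and [measurable]: "k \<in> borel_measurable M"
  shows "(\<lambda>n. LINT x|M. bump r s n (k x) * v x) \<longlonglongrightarrow> (LINT x|M. indicator {r<..<s} (k x) * v x)"
proof (rule integral_dominated_convergence[where w="\<lambda>x. \<bar>v x\<bar>"])
  have [measurable]: "v \<in> borel_measurable M" using assms by simp
  have b: "bump r s n \<in> borel_measurable borel" for n
    by (intro borel_measurable_continuous_onI smooth_continuous smooth_bump)
  have [measurable]: "(\<lambda>x. bump r s n (k x)) \<in> borel_measurable M" for n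
    by (rule measurable_compose[OF _ b]) simp
  show "(\<lambda>x. bump r s n (k x) * v x) \<in> borel_measurable M" for n by measurable
  show "(\<lambda>x. indicator {r<..<s} (k x) * v x) \<in> borel_measurable M" by measurable
  show "AE x in M. (\<lambda>n. bump r s n (k x) * v x) \<longlonglongrightarrow> indicator {r<..<s} (k x) * v x"
    by (intro AE_I2 tendsto_mult bump_tendsto tendsto_const)
  show "AE x in M. norm (bump r s n (k x) * v x) \<le> \<bar>v x\<bar>" for n
    using bump_bounds[of r s n] by (intro AE_I2) (simp add: abs_mult mult_left_le_one_le)
qed (use assms in auto)

lemma integral_bump_lborel_tendsto:
  assumes "r \<le> s"
  shows "(\<lambda>n. LINT x|lborel. bump r s n x) \<longlonglongrightarrow> s - r"
proof -
  have "integrable lborel (\<lambda>x. indicator {r<..<s} x :: real)"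
    by (simp add: assms)
  from integral_bump_tendsto[OF this, of "\<lambda>x. x" r s]
  have "(\<lambda>n. LINT x|lborel. bump r s n x * indicator {r<..<s} x) \<longlonglongrightarrow>
      (LINT x|lborel. indicator {r<..<s} x * indicator {r<..<s} x)" by simp
  moreover have "bump r s n x * indicator {r<..<s} x = bump r s n x" for n x
    using bump_zero[of x r s n] by (cases "r < x \<and> x < s") auto
  ultimately show ?thesis using assms
    by (simp flip: indicator_inter_arith)
qed

lemma indicator_inner_self_integrable:
  assumes B: "B \<subseteq> {..s}" and [measurable]: "B \<in> sets borel"
  shows "integrable lebesgue (\<lambda>x::real^2. indicator B (x \<bullet> x) :: real)"
proof -
  have i: "integrable lebesgue (\<lambda>x::real^2. indicator (cball 0 (sqrt s)) x :: real)"
    using emeasure_lborel_cball_finite[of "0::real^2" "sqrt s"]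
    by (intro integrable_real_indicator) auto
  show ?thesis
  proof (rule Bochner_Integration.integrable_bound[OF i])
    show "AE x in lebesgue. norm (indicator B (x \<bullet> x) :: real) \<le> norm (indicator (cball 0 (sqrt s)) (x::real^2) :: real)"
      using B by (intro AE_I2) (auto simp: indicator_def norm_eq_sqrt_inner)
  qed measurable
qed

text \<open>Subtracting a multiple of one fixed bump gives any other bump mean zero, so the pairing
  of \<open>v\<close> with \<psi>(|x|^2) is \<open>C\<close> times the integral of \<psi>, for every
  bump \<psi> supported in [p, q]. In the limit the integral of \<open>v\<close> over r < |x|^2 < s
  is C (s - r), while the area is pi (s - r); hence the constant is C / pi.\<close>

lemma radial_du_Bois_Reymond:
  fixes v :: "real^2 \<Rightarrow> real"
  assumes v: "integrable lebesgue v" and k: "AE x in lebesgue. v x = k (x \<bullet> x)"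
    and supp: "\<And>x. x \<bullet> x \<notin> {p<..<q} \<Longrightarrow> v x = 0" and pq: "0 \<le> p" "p < q"
    and ortho: "\<And>\<psi>. smooth \<psi> \<Longrightarrow> (\<And>x. x \<le> p \<or> q \<le> x \<Longrightarrow> \<psi> x = 0) \<Longrightarrow>
      (LINT x|lborel. \<psi> x) = 0 \<Longrightarrow> (LINT x|lebesgue. \<psi> (x \<bullet> x) * v x) = 0"
  shows "\<exists>c. AE x in lebesgue. x \<bullet> x \<in> {p<..<q} \<longrightarrow> v x = c"
proof -
  have lb: "integrable lborel (bump r s n)" for r s n
  proof -
    have "integrable lborel (\<lambda>x. indicator {r..s} x *\<^sub>R bump r s n x)"
      by (intro borel_integrable_compact compact_Icc smooth_continuous smooth_bump)
    moreover have "(\<lambda>x. indicator {r..s} x *\<^sub>R bump r s n x) = bump r s n"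
    proof
      show "indicator {r..s} x *\<^sub>R bump r s n x = bump r s n x" for x
        using bump_zero[of x r s n] by (cases "r \<le> x \<and> x \<le> s") auto
    qed
    ultimately show ?thesis by simp
  qed
  have [measurable]: "bump r s n \<in> borel_measurable borel" for r s n
    by (intro borel_measurable_continuous_onI smooth_continuous smooth_bump)
  have [measurable]: "v \<in> borel_measurable lebesgue" using v by simp
  have vb: "integrable lebesgue (\<lambda>x. bump r s n (x \<bullet> x) * v x)" for r s n
    by (rule Bochner_Integration.integrable_bound[OF v])
       (use bump_bounds[of r s n] in \<open>auto simp: abs_mult mult_left_le_one_le\<close>)
  have "\<forall>\<^sub>F n in sequentially. 0 < (LINT x|lborel. bump p q n x)"
    by (rule order_tendstoD(1)[OF integral_bump_lborel_tendsto]) (use pq in auto)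
  \<comment> \<open>Any index whose bump has positive integral serves to normalise; one exists
    because the integrals tend to q - p.\<close>
  then obtain m where m: "0 < (LINT x|lborel. bump p q m x)"
    by (auto simp: eventually_sequentially)
  define I where "I = (LINT x|lborel. bump p q m x)"
  define C where "C = (LINT x|lebesgue. bump p q m (x \<bullet> x) * v x) / I"
  have I: "I \<noteq> 0" using m by (simp add: I_def)
  have scale: "(LINT x|lebesgue. bump r s n (x \<bullet> x) * v x) = C * (LINT x|lborel. bump r s n x)"
    if "p \<le> r" "s \<le> q" for r s n
  proof -
    define J where "J = (LINT x|lborel. bump r s n x)"
    have "(LINT x|lebesgue. (bump r s n (x \<bullet> x) - J / I * bump p q m (x \<bullet> x)) * v x) = 0"
    proof (rule ortho)
      show "smooth (\<lambda>x. bump r s n x - J / I * bump p q m x)"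
        by (intro smooth_diff smooth_cmult smooth_bump)
      show "bump r s n x - J / I * bump p q m x = 0" if "x \<le> p \<or> q \<le> x" for x
        using that \<open>p \<le> r\<close> \<open>s \<le> q\<close> bump_zero[of x r s n] bump_zero[of x p q m] by auto
      show "(LINT x|lborel. bump r s n x - J / I * bump p q m x) = 0"
        using lb I by (simp add: J_def I_def)
    qed
    also have "(LINT x|lebesgue. (bump r s n (x \<bullet> x) - J / I * bump p q m (x \<bullet> x)) * v x)
       = (LINT x|lebesgue. bump r s n (x \<bullet> x) * v x - J / I * (bump p q m (x \<bullet> x) * v x))"
      by (rule Bochner_Integration.integral_cong) (auto simp: algebra_simps)
    also have "\<dots> = (LINT x|lebesgue. bump r s n (x \<bullet> x) * v x) - J * C"
      using vb by (simp add: C_def)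
    finally show ?thesis by (simp add: J_def)
  qed
  have int: "(LINT x|lebesgue. indicator {r<..<s} (x \<bullet> x) * v x) = C * (s - r)"
    if "p \<le> r" "r \<le> s" "s \<le> q" for r s
  proof (rule LIMSEQ_unique)
    show "(\<lambda>n. LINT x|lebesgue. bump r s n (x \<bullet> x) * v x)
        \<longlonglongrightarrow> (LINT x|lebesgue. indicator {r<..<s} (x \<bullet> x) * v x)"
      by (rule integral_bump_tendsto[OF v]) simp
    show "(\<lambda>n. LINT x|lebesgue. bump r s n (x \<bullet> x) * v x) \<longlonglongrightarrow> C * (s - r)"
      using tendsto_mult[OF tendsto_const integral_bump_lborel_tendsto[OF that(2)]] that
      by (simp add: scale)
  qed
  have area: "(LINT x|lebesgue. indicator {r<..<s} ((x::real^2) \<bullet> x)) = pi * (s - r)"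
    if "0 \<le> r" "r \<le> s" for r s :: real
  proof -
    have "(LINT x|lebesgue. indicator {r<..<s} ((x::real^2) \<bullet> x))
        = pi * (LINT x|lborel. indicator {0..} x * indicator {r<..<s} x)"
      by (rule integral_radial) simp
    also have "(\<lambda>x. indicator {0..} x * indicator {r<..<s} x) = (indicator {r<..<s} :: real \<Rightarrow> real)"
      using that by (auto simp: indicator_def fun_eq_iff)
    finally show ?thesis using that by simp
  qed
  have areai: "integrable lebesgue (\<lambda>x::real^2. indicator {r<..<s} (x \<bullet> x) :: real)" for r s :: real
    by (rule indicator_inner_self_integrable[of _ s]) auto
  define w where "w x = v x - C / pi * indicator {p<..<q} (x \<bullet> x)" for x
  have w: "integrable lebesgue w"
    unfolding w_def using v areai[of p q] by simp
  have w0: "(LINT x|lebesgue. indicator {r<..<s} (x \<bullet> x) * w x) = 0" for r s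
  proof -
    \<comment> \<open>The interval is clipped to [p, q], outside of which \<open>w\<close> vanishes;
      the outer \<open>max\<close> in \<open>s'\<close> keeps r' \<le> s' when nothing
      remains.\<close>
    define r' where "r' = max r p"
    define s' where "s' = max r' (min s q)"
    have *: "indicator {r<..<s} (x \<bullet> x) * w x
      = indicator {r'<..<s'} (x \<bullet> x) * v x - C / pi * indicator {r'<..<s'} (x \<bullet> x)" for x
      using supp[of x] by (auto simp: w_def indicator_def r'_def s'_def)
    show ?thesis
    proof (cases "r' \<le> q")
      case True
      then have b: "p \<le> r'" "r' \<le> s'" "s' \<le> q" by (auto simp: r'_def s'_def)
      have i: "integrable lebesgue (\<lambda>x. indicator {r'<..<s'} (x \<bullet> x) * v x)"
        by (rule Bochner_Integration.integrable_bound[OF v]) (auto simp: indicator_def[abs_def])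
      have "(LINT x|lebesgue. indicator {r<..<s} (x \<bullet> x) * w x) = C * (s' - r') - C / pi * (pi * (s' - r'))"
        unfolding * using i areai[of r' s'] b pq by (simp add: int area)
      then show ?thesis by simp
    next
      case False
      then have "s' = r'" by (auto simp: r'_def s'_def)
      then show ?thesis unfolding * by simp
    qed
  qed
  have "AE x in lebesgue. w x = 0"
  proof (rule radial_AE_zero[OF w])
    show "AE x in lebesgue. w x = k (x \<bullet> x) - C / pi * indicator {p<..<q} (x \<bullet> x)"
      using k by eventually_elim (simp add: w_def)
    show "(LINT x|lebesgue. indicator B (x \<bullet> x) * w x) = 0" if "B \<in> sets borel" for B
      by (rule integral_Borel_from_intervals[of w p q, OF w _ w0 that])
         (simp add: w_def supp)
  qed
  then have "AE x in lebesgue. x \<bullet> x \<in> {p<..<q} \<longrightarrow> v x = C / pi"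
    by eventually_elim (auto simp: w_def)
  then show ?thesis by blast
qed

section \<open>Weak gradients of radial functions\<close>

lemma L1_loc_mult_integrable:
  fixes u f :: "'a::euclidean_space \<Rightarrow> real"
  assumes u: "u \<in> L1_loc" and [measurable]: "f \<in> borel_measurable borel"
    and b: "\<And>x. \<bar>f x\<bar> \<le> C" and z: "\<And>x. x \<bullet> x > R \<Longrightarrow> f x = 0"
  shows "integrable lebesgue (\<lambda>x. u x * f x)"
proof -
  let ?K = "cball (0::'a) (sqrt R)"
  have [measurable]: "u \<in> borel_measurable lebesgue" using u by (simp add: L1_loc_def)
  have i: "integrable lebesgue (\<lambda>x. C * (indicator ?K x *\<^sub>R u x))"
    using u by (auto simp: L1_loc_def set_integrable_def intro!: integrable_mult_right)
  have mf: "f \<in> borel_measurable lebesgue"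
    by (rule measurable_completion) simp
  show ?thesis
  proof (rule Bochner_Integration.integrable_bound[OF i])
    show "(\<lambda>x. u x * f x) \<in> borel_measurable lebesgue" using mf by measurable
    show "AE x in lebesgue. norm (u x * f x) \<le> norm (C * (indicator ?K x *\<^sub>R u x))"
    proof (rule AE_I2)
      fix x
      show "norm (u x * f x) \<le> norm (C * (indicator ?K x *\<^sub>R u x))"
      proof (cases "x \<bullet> x > R")
        case False
        then have "x \<in> ?K" by (simp add: norm_eq_sqrt_inner)
        then show ?thesis using b[of x] order_trans[OF abs_ge_zero b[of x]]
          by (simp add: abs_mult mult.commute[of C] mult_left_mono)
      qed (simp add: z)
    qed
  qed
qed

lemma L1_loc_inner:
  fixes g :: "'a::euclidean_space \<Rightarrow> 'b::euclidean_space"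
  assumes "g \<in> L1_loc" shows "(\<lambda>x. g x \<bullet> e) \<in> L1_loc"
proof -
  have "set_integrable lebesgue K (\<lambda>x. g x \<bullet> e)" if "compact K" for K
  proof -
    have "integrable lebesgue (\<lambda>x. (indicator K x *\<^sub>R g x) \<bullet> e)"
      using assms that by (intro integrable_inner_left) (auto simp: L1_loc_def set_integrable_def)
    then show ?thesis by (simp add: set_integrable_def)
  qed
  then show ?thesis using assms by (auto simp: L1_loc_def)
qed

lemma continuous_bounded_compact_support:
  fixes h :: "real \<Rightarrow> real"
  assumes "continuous_on UNIV h" "\<And>x. x \<le> p \<or> q \<le> x \<Longrightarrow> h x = 0"
  shows "\<exists>C. \<forall>x. \<bar>h x\<bar> \<le> C"
proof -
  have "bounded (h ` {p..q})"
    by (intro compact_imp_bounded compact_continuous_image continuous_on_subset[OF assms(1)]) auto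
  then obtain C where C: "\<And>x. p \<le> x \<Longrightarrow> x \<le> q \<Longrightarrow> \<bar>h x\<bar> \<le> C"
    by (force simp: bounded_iff)
  have "\<bar>h x\<bar> \<le> max C 0" for x
    using C[of x] assms(2)[of x] by (cases "p \<le> x \<and> x \<le> q") auto
  then show ?thesis by blast
qed

text \<open>The test functions are the components of the vector field
  \<open>\<eta>(|x|\<^sup>2) x / |x|\<^sup>2\<close>, whose divergence is \<open>2 \<eta>'(|x|\<^sup>2)\<close> because
  \<open>x / |x|\<^sup>2\<close> is divergence free in the punctured plane.\<close>

lemma weak_gradient_radial_test:
  fixes u :: "real^2 \<Rightarrow> real"
  assumes wg: "has_weak_gradient u g" and p: "0 < p"
    and \<eta>: "smooth \<eta>" "\<And>x. (\<eta> has_real_derivative \<psi> x) (at x)"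
    and z: "\<And>x. x \<le> p \<or> q \<le> x \<Longrightarrow> \<eta> x = 0" "\<And>x. x \<le> p \<or> q \<le> x \<Longrightarrow> \<psi> x = 0"
  shows "2 * (LINT x|lebesgue. u x * \<psi> (x \<bullet> x))
    = - (LINT x|lebesgue. (g x \<bullet> x) / (x \<bullet> x) * \<eta> (x \<bullet> x))"
proof -
  \<comment> \<open>The test function in direction \<open>e\<close> is \<zeta>(|x|^2) (x \<bullet>
    e); the division by t is harmless because \<eta> vanishes for t \<le> p. In these terms \<psi> =
    \<zeta> + t \<zeta>'.\<close>
  define \<zeta> where "\<zeta> x = \<eta> x / x" for x
  have "smooth \<zeta>" unfolding \<zeta>_def
    by (rule smooth_divide_id[OF \<eta>(1) p]) (use z in auto)
  then obtain \<zeta>' where \<zeta>': "\<And>x. (\<zeta> has_real_derivative \<zeta>' x) (at x)" "smooth \<zeta>'"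
    by (blast elim: smooth_derivE)
  have \<eta>_eq: "\<eta> = (\<lambda>x. x * \<zeta> x)"
    using z p by (auto simp: \<zeta>_def fun_eq_iff)
  have \<psi>_eq: "\<psi> x = \<zeta> x + x * \<zeta>' x" for x
  proof -
    have "((\<lambda>x. x * \<zeta> x) has_real_derivative x * \<zeta>' x + 1 * \<zeta> x) (at x)"
      by (rule DERIV_mult'[OF DERIV_ident \<zeta>'(1)])
    from DERIV_unique[OF this \<eta>(2)[unfolded \<eta>_eq]] show ?thesis by simp
  qed
  have z\<zeta>: "\<zeta> x = 0" if "x \<le> p \<or> q \<le> x" for x
    using z(1)[OF that] by (simp add: \<zeta>_def)
  \<comment> \<open>Control of the product t \<zeta>'(t) is enough: in the derivative of the test
    function \<zeta>' is multiplied by (x \<bullet> e)^2 \<le> |x|^2.\<close>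
  have z\<zeta>': "x * \<zeta>' x = 0" if "x \<le> p \<or> q \<le> x" for x
    using z(2)[OF that] z\<zeta>[OF that] \<psi>_eq[of x] by simp
  have "continuous_on UNIV (\<lambda>x. x * \<zeta>' x)"
    by (intro continuous_intros smooth_continuous \<zeta>')
  from continuous_bounded_compact_support[OF this z\<zeta>']
  obtain C1 where C1: "\<And>x. \<bar>x * \<zeta>' x\<bar> \<le> C1" by blast
  from continuous_bounded_compact_support[OF smooth_continuous[OF \<open>smooth \<zeta>\<close>] z\<zeta>]
  obtain C2 where C2: "\<And>x. \<bar>\<zeta> x\<bar> \<le> C2" by blast
  note C = C1 C2
  have [measurable]: "\<zeta> \<in> borel_measurable borel" "\<zeta>' \<in> borel_measurable borel"
    by (intro borel_measurable_continuous_onI smooth_continuous \<open>smooth \<zeta>\<close> \<zeta>')+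
  have u: "u \<in> L1_loc" and g: "g \<in> L1_loc" using wg by (auto simp: has_weak_gradient_def)
  have sq: "(x \<bullet> e)\<^sup>2 \<le> x \<bullet> x" if "e \<in> Basis" for x e :: "real^2"
    using Cauchy_Schwarz_ineq[of x e] that by (simp add: inner_same_Basis)
  let ?L = "\<lambda>x e. \<zeta> (x \<bullet> x) + 2 * \<zeta>' (x \<bullet> x) * (x \<bullet> e)\<^sup>2"
  have iL: "integrable lebesgue (\<lambda>x. u x * ?L x e)" if e: "e \<in> Basis" for e
  proof (rule L1_loc_mult_integrable[OF u, where C = "C2 + 2 * C1" and R = q])
    show "\<bar>?L x e\<bar> \<le> C2 + 2 * C1" for x
    proof -
      have "\<bar>\<zeta>' (x \<bullet> x) * (x \<bullet> e)\<^sup>2\<bar> \<le> \<bar>(x \<bullet> x) * \<zeta>' (x \<bullet> x)\<bar>"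
        using mult_left_mono[OF sq[OF e, of x], of "\<bar>\<zeta>' (x \<bullet> x)\<bar>"]
        by (simp add: abs_mult mult.commute)
      with C(1)[of "x \<bullet> x"] C(2)[of "x \<bullet> x"] show ?thesis by linarith
    qed
    show "?L x e = 0" if "q < x \<bullet> x" for x
      using z\<zeta>[of "x \<bullet> x"] z\<zeta>'[of "x \<bullet> x"] that by auto
  qed measurable
  have iR: "integrable lebesgue (\<lambda>x. (g x \<bullet> e) * (\<zeta> (x \<bullet> x) * (x \<bullet> e)))" if e: "e \<in> Basis" for e
  proof (rule L1_loc_mult_integrable[OF L1_loc_inner[OF g], where C = "C2 * sqrt (max q 0)" and R = q])
    show "\<bar>\<zeta> (x \<bullet> x) * (x \<bullet> e)\<bar> \<le> C2 * sqrt (max q 0)" for x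
    proof (cases "q \<le> x \<bullet> x")
      case True
      then show ?thesis using z\<zeta>[of "x \<bullet> x"] order_trans[OF abs_ge_zero C(2)] by simp
    next
      case False
      then have "(x \<bullet> e)\<^sup>2 \<le> max q 0" using sq[OF e, of x] by simp
      then have "\<bar>x \<bullet> e\<bar> \<le> sqrt (max q 0)" by (rule real_le_rsqrt[of "\<bar>x \<bullet> e\<bar>", simplified])
      then show ?thesis unfolding abs_mult
        by (intro mult_mono C order_trans[OF abs_ge_zero C(2)]) auto
    qed
    show "\<zeta> (x \<bullet> x) * (x \<bullet> e) = 0" if "q < x \<bullet> x" for x
      using z\<zeta>[of "x \<bullet> x"] that by auto
  qed measurable
  have eq: "(LINT x|lebesgue. u x * ?L x e) = - (LINT x|lebesgue. (g x \<bullet> e) * (\<zeta> (x \<bullet> x) * (x \<bullet> e)))"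
    if e: "e \<in> Basis" for e
  proof -
    have "test_function (\<lambda>x::real^2. \<zeta> (x \<bullet> x) * (x \<bullet> e))"
      by (rule test_function_radial[OF \<open>smooth \<zeta>\<close>, of q]) (use z\<zeta> in auto)
    then have "(LINT x|lebesgue. u x * frechet_derivative (\<lambda>x. \<zeta> (x \<bullet> x) * (x \<bullet> e)) (at x) e)
        = - (LINT x|lebesgue. (g x \<bullet> e) * (\<zeta> (x \<bullet> x) * (x \<bullet> e)))"
      using wg e by (auto simp: has_weak_gradient_def)
    then show ?thesis
      using e by (simp add: frechet_derivative_radial[OF \<zeta>'(1)] power2_eq_square mult.assoc)
  qed
  have sumsq: "(\<Sum>e\<in>Basis. (x \<bullet> e)\<^sup>2) = x \<bullet> x" for x :: "real^2"
    by (subst euclidean_inner[of x x]) (simp add: power2_eq_square)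
  have "2 * (LINT x|lebesgue. u x * \<psi> (x \<bullet> x)) = (LINT x|lebesgue. (\<Sum>e\<in>Basis. u x * ?L x e))"
  proof -
    \<comment> \<open>Here the dimension enters: the two basis vectors contribute 2 \<zeta> + 2
      |x|^2 \<zeta>' = 2 \<psi>(|x|^2).\<close>
    have "(\<Sum>e\<in>Basis. u x * ?L x e) = 2 * (u x * \<psi> (x \<bullet> x))" for x
    proof -
      have "(\<Sum>e\<in>Basis. u x * ?L x e) = u x * (\<Sum>e\<in>Basis. ?L x e)"
        by (simp add: sum_distrib_left)
      also have "(\<Sum>e\<in>Basis. ?L x e) = 2 * \<zeta> (x \<bullet> x) + 2 * \<zeta>' (x \<bullet> x) * (\<Sum>e\<in>Basis. (x \<bullet> e)\<^sup>2)"
        by (simp add: sum.distrib sum_distrib_left)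
      finally show ?thesis by (simp add: sumsq \<psi>_eq algebra_simps)
    qed
    then show ?thesis by simp
  qed
  also have "\<dots> = (\<Sum>e\<in>Basis. LINT x|lebesgue. u x * ?L x e)"
    by (rule Bochner_Integration.integral_sum) (rule iL)
  also have "\<dots> = (\<Sum>e\<in>Basis. - (LINT x|lebesgue. (g x \<bullet> e) * (\<zeta> (x \<bullet> x) * (x \<bullet> e))))"
    by (rule sum.cong) (use eq in auto)
  also have "\<dots> = - (LINT x|lebesgue. (\<Sum>e\<in>Basis. (g x \<bullet> e) * (\<zeta> (x \<bullet> x) * (x \<bullet> e))))"
    by (subst Bochner_Integration.integral_sum[OF iR]) (simp_all add: sum_negf)
  also have "(\<lambda>x. \<Sum>e\<in>Basis. (g x \<bullet> e) * (\<zeta> (x \<bullet> x) * (x \<bullet> e)))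
      = (\<lambda>x. (g x \<bullet> x) / (x \<bullet> x) * \<eta> (x \<bullet> x))"
  proof
    fix x
    have "(\<Sum>e\<in>Basis. (g x \<bullet> e) * (\<zeta> (x \<bullet> x) * (x \<bullet> e))) = \<zeta> (x \<bullet> x) * (g x \<bullet> x)"
      by (subst (2) euclidean_inner) (simp add: sum_distrib_left mult_ac)
    then show "(\<Sum>e\<in>Basis. (g x \<bullet> e) * (\<zeta> (x \<bullet> x) * (x \<bullet> e))) = (g x \<bullet> x) / (x \<bullet> x) * \<eta> (x \<bullet> x)"
      by (simp add: \<zeta>_def)
  qed
  finally show ?thesis .
qed

text \<open>The disc integral of \<open>G\<close> is a weak primitive in the radial variable: after
  exchanging the integrations, the inner integral of \<psi>(|x|^2) over |x| \<ge> |y| is pi times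
  the integral of \<psi> from |y|^2 on, that is - pi \<eta>(|y|^2).\<close>

lemma Fubini_radial_primitive:
  fixes G :: "real^2 \<Rightarrow> real"
  assumes G: "integrable lebesgue G"
    and d: "\<And>x. (\<eta> has_real_derivative \<psi> x) (at x)" and \<psi>: "continuous_on UNIV \<psi>"
    and z: "\<And>x. x \<le> p \<or> q \<le> x \<Longrightarrow> \<eta> x = 0" "\<And>x. x \<le> p \<or> q \<le> x \<Longrightarrow> \<psi> x = 0"
  shows "(LINT x|lebesgue. (LINT y|lebesgue. G y * indicator {..(x::real^2) \<bullet> x} (y \<bullet> y)) * \<psi> (x \<bullet> x))
      = - pi * (LINT y|lebesgue. G y * \<eta> (y \<bullet> y))"
    and "(\<lambda>x::real^2. LINT y|lebesgue. G y * indicator {..x \<bullet> x} (y \<bullet> y)) \<in> borel_measurable lebesgue"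
proof -
  have [measurable]: "\<psi> \<in> borel_measurable borel"
    using \<psi> by (rule borel_measurable_continuous_onI)
  have "continuous_on UNIV \<eta>"
    using d by (meson DERIV_isCont continuous_at_imp_continuous_on)
  then have [measurable]: "\<eta> \<in> borel_measurable borel"
    by (rule borel_measurable_continuous_onI)
  \<comment> \<open>Fubini is applied to the product of the uncompleted measures, so
    \<open>G\<close> is exchanged for a Borel function that agrees with it almost
    everywhere.\<close>
  obtain H where H[measurable]: "H \<in> borel_measurable lborel" and GH: "AE x in lborel. G x = H x"
    using completion_ex_borel_measurable_real[of G lborel] G by auto
  have GH': "AE x in lebesgue. G x = H x" using GH by (rule AE_completion)
  have Hm: "H \<in> borel_measurable lebesgue" by (rule measurable_completion) simp
  have Gm: "G \<in> borel_measurable lebesgue" using G by simp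
  have "integrable lebesgue H"
    using G GH' Hm by (subst integrable_cong_AE[of _ _ G]) auto
  then have Hi: "integrable lborel H" by (simp add: integrable_completion)
  define W where "W r = (LINT y|lborel. H y * (if y \<bullet> y \<le> r then 1 else 0))" for r
  have W: "(LINT y|lebesgue. G y * indicator {..r} (y \<bullet> y)) = W r" for r
  proof -
    have "(LINT y|lebesgue. G y * indicator {..r} (y \<bullet> y)) = (LINT y|lebesgue. H y * (if y \<bullet> y \<le> r then 1 else 0))"
    proof (rule integral_cong_AE)
      show "(\<lambda>y. G y * indicator {..r} (y \<bullet> y)) \<in> borel_measurable lebesgue" using Gm by measurable
      show "(\<lambda>y. H y * (if y \<bullet> y \<le> r then 1 else 0)) \<in> borel_measurable lebesgue" using Hm by measurable
      show "AE y in lebesgue. G y * indicator {..r} (y \<bullet> y) = H y * (if y \<bullet> y \<le> r then 1 else 0)"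
        using GH' by eventually_elim (simp add: indicator_def)
    qed
    then show ?thesis unfolding W_def by (subst (asm) integral_completion) auto
  qed
  have Wm[measurable]: "W \<in> borel_measurable borel"
    unfolding W_def by measurable
  show "(\<lambda>x::real^2. LINT y|lebesgue. G y * indicator {..x \<bullet> x} (y \<bullet> y)) \<in> borel_measurable lebesgue"
    unfolding W by measurable
  define K where "K = (\<lambda>(x::real^2) (y::real^2). \<psi> (x \<bullet> x) * (H y * (if y \<bullet> y \<le> x \<bullet> x then 1 else 0)))"
  obtain C where C: "\<And>x. \<bar>\<psi> x\<bar> \<le> C"
    using continuous_bounded_compact_support[OF \<psi> z(2)] by blast
  have \<psi>i: "integrable lborel (\<lambda>x::real^2. \<psi> (x \<bullet> x))"
  proof -
    have "integrable lborel (\<lambda>x::real^2. C * indicator (cball 0 (sqrt q)) x)"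
      using emeasure_lborel_cball_finite[of "0::real^2" "sqrt q"]
      by (intro integrable_mult_right integrable_real_indicator) auto
    then show ?thesis
    proof (rule Bochner_Integration.integrable_bound)
      show "AE x in lborel. norm (\<psi> (x \<bullet> x)) \<le> norm (C * indicator (cball 0 (sqrt q)) (x::real^2))"
      proof (rule AE_I2)
        fix x :: "real^2"
        show "norm (\<psi> (x \<bullet> x)) \<le> norm (C * indicator (cball 0 (sqrt q)) x)"
        proof (cases "q \<le> x \<bullet> x")
          case False
          then have "x \<in> cball 0 (sqrt q)" by (simp add: norm_eq_sqrt_inner)
          then show ?thesis using order_trans[OF C abs_ge_self] by simp
        qed (use z in simp)
      qed
    qed measurable
  qed
  have int: "integrable (lborel \<Otimes>\<^sub>M lborel) (case_prod K)"
  proof -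
    \<comment> \<open>Integrability on the product follows by dropping the cut-off: \<open>K\<close>
      is dominated by a product of a function of \<open>x\<close> and a function of
      \<open>y\<close>.\<close>
    have "integrable (lborel \<Otimes>\<^sub>M lborel) (\<lambda>z::(real^2)\<times>(real^2). \<psi> (fst z \<bullet> fst z) * H (snd z))"
    proof (rule lborel_pair.Fubini_integrable)
      show "integrable lborel (\<lambda>x::real^2. LINT y|lborel. norm (\<psi> (fst (x, y) \<bullet> fst (x, y)) * H (snd (x, y))))"
        using \<psi>i by (simp add: abs_mult)
      show "AE x::real^2 in lborel. integrable lborel (\<lambda>y. \<psi> (fst (x, y) \<bullet> fst (x, y)) * H (snd (x, y)))"
        using Hi by simp
    qed measurable
    then show ?thesis
    proof (rule Bochner_Integration.integrable_bound)
      show "case_prod K \<in> borel_measurable (lborel \<Otimes>\<^sub>M lborel)"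
        unfolding K_def by measurable
    qed (auto simp: K_def abs_mult)
  qed
  have "(LINT x|lebesgue. (LINT y|lebesgue. G y * indicator {..(x::real^2) \<bullet> x} (y \<bullet> y)) * \<psi> (x \<bullet> x))
    = (LINT x|lborel. W ((x::real^2) \<bullet> x) * \<psi> (x \<bullet> x))"
    unfolding W by (rule integral_completion) measurable
  also have "\<dots> = (LINT x|lborel. (LINT y|lborel. K x y))"
    by (simp add: K_def W_def mult.commute)
  also have "\<dots> = (LINT y|lborel. (LINT x|lborel. K x y))"
    by (rule lborel_pair.Fubini_integral[OF int, symmetric])
  also have "\<dots> = (LINT y|lborel. - pi * (H y * \<eta> (y \<bullet> y)))"
  proof (rule Bochner_Integration.integral_cong)
    fix y :: "real^2"
    have "(LINT x|lborel. K x y) = H y * (LINT x|lborel. indicator {y \<bullet> y..} ((x::real^2) \<bullet> x) * \<psi> (x \<bullet> x))"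
    proof -
      have "K x y = H y * (indicator {y \<bullet> y..} (x \<bullet> x) * \<psi> (x \<bullet> x))" for x
        by (simp add: K_def indicator_def)
      then show ?thesis by simp
    qed
    also have "(LINT x|lborel. indicator {y \<bullet> y..} ((x::real^2) \<bullet> x) * \<psi> (x \<bullet> x))
      = (LINT x|lebesgue. indicator {y \<bullet> y..} ((x::real^2) \<bullet> x) * \<psi> (x \<bullet> x))"
      by (rule integral_completion[symmetric]) measurable
    also have "\<dots> = pi * (LINT r|lborel. indicator {0..} r * (indicator {y \<bullet> y..} r * \<psi> r))"
      by (rule integral_radial) measurable
    also have "(\<lambda>r. indicator {0..} r * (indicator {y \<bullet> y..} r * \<psi> r)) = (\<lambda>r. indicator {y \<bullet> y..} r * \<psi> r)"
      using order_trans[OF inner_ge_zero[of y]] by (auto simp: fun_eq_iff indicator_def)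
    also have "(LINT r|lborel. indicator {y \<bullet> y..} r * \<psi> r) = - \<eta> (y \<bullet> y)"
      by (rule integral_deriv_atLeast[OF d \<psi>]) (use z in auto)
    finally show "(LINT x|lborel. K x y) = - pi * (H y * \<eta> (y \<bullet> y))" by simp
  qed simp
  also have "\<dots> = - pi * (LINT y|lborel. H y * \<eta> (y \<bullet> y))" by simp
  also have "(LINT y|lborel. H y * \<eta> (y \<bullet> y)) = (LINT y|lebesgue. H y * \<eta> (y \<bullet> y))"
    by (rule integral_completion[symmetric]) measurable
  also have "\<dots> = (LINT y|lebesgue. G y * \<eta> (y \<bullet> y))"
  proof (rule integral_cong_AE)
    have e: "(\<lambda>y::real^2. \<eta> (y \<bullet> y)) \<in> borel_measurable lebesgue" by measurable
    show "(\<lambda>y. H y * \<eta> (y \<bullet> y)) \<in> borel_measurable lebesgue" using Hm e by measurable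
    show "(\<lambda>y. G y * \<eta> (y \<bullet> y)) \<in> borel_measurable lebesgue" using Gm e by measurable
    show "AE y in lebesgue. H y * \<eta> (y \<bullet> y) = G y * \<eta> (y \<bullet> y)"
      using GH' by eventually_elim simp
  qed
  finally show "(LINT x|lebesgue. (LINT y|lebesgue. G y * indicator {..(x::real^2) \<bullet> x} (y \<bullet> y)) * \<psi> (x \<bullet> x))
      = - pi * (LINT y|lebesgue. G y * \<eta> (y \<bullet> y))" .
qed

text \<open>Paired with \<psi>(|x|^2), \<open>u\<close> yields -1/2 times the integral of G
  \<eta>(|y|^2), and the disc integral of \<open>G\<close> yields - pi times it. Hence
  \<open>u\<close> minus the disc integral divided by 2 pi annihilates every mean-zero \<psi>
  supported in [p, q] and is constant on the annulus.\<close>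

lemma radial_weak_gradient_annulus:
  fixes u :: "real^2 \<Rightarrow> real"
  assumes wg: "has_weak_gradient u g" and rad: "AE x in lebesgue. u x = f (norm x)"
    and p: "0 < p" and pq: "p < q"
  defines "G \<equiv> (\<lambda>y. (g y \<bullet> y) / (y \<bullet> y) * indicator {p<..<q} (y \<bullet> y))"
  shows "integrable lebesgue G"
    and "\<exists>c. AE x in lebesgue. x \<bullet> x \<in> {p<..<q} \<longrightarrow>
      u x = c + (LINT y|lebesgue. G y * indicator {..x \<bullet> x} (y \<bullet> y)) / (2 * pi)"
proof -
  let ?A = "{p<..<q}"
  have u: "u \<in> L1_loc" and g: "g \<in> L1_loc" using wg by (auto simp: has_weak_gradient_def)
  show Gi: "integrable lebesgue G"
  proof -
    have "integrable lebesgue (\<lambda>y. (g y \<bullet> e) * ((y \<bullet> e) / (y \<bullet> y) * indicator ?A (y \<bullet> y)))"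
      if e: "e \<in> Basis" for e
    proof (rule L1_loc_mult_integrable[OF L1_loc_inner[OF g], where C = "1 / p + 1" and R = q])
      show "\<bar>(y \<bullet> e) / (y \<bullet> y) * indicator ?A (y \<bullet> y)\<bar> \<le> 1 / p + 1" for y :: "real^2"
      proof (cases "y \<bullet> y \<in> ?A")
        case True
        then have y: "p < y \<bullet> y" by simp
        \<comment> \<open>A bound by 1 + |y|^2 avoids square roots; dividing by |y|^2 > p yields 1/p
          + 1.\<close>
        have "\<bar>y \<bullet> e\<bar> \<le> 1 + (y \<bullet> e)\<^sup>2"
          using sum_squares_bound[of 1 "\<bar>y \<bullet> e\<bar>"] by simp
        also have "\<dots> \<le> 1 + y \<bullet> y"
          using Cauchy_Schwarz_ineq[of y e] e by (simp add: inner_same_Basis)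
        finally have "\<bar>y \<bullet> e\<bar> / (y \<bullet> y) \<le> (1 + y \<bullet> y) / (y \<bullet> y)"
          by (rule divide_right_mono) simp
        also have "\<dots> = 1 / (y \<bullet> y) + 1"
        proof -
          have "y \<bullet> y \<noteq> 0" using y p by linarith
          then show ?thesis by (simp add: add_divide_distrib del: inner_eq_zero_iff)
        qed
        also have "\<dots> \<le> 1 / p + 1" using y p by (simp add: frac_le)
        finally show ?thesis using True by simp
      qed (use p in simp)
      show "(y \<bullet> e) / (y \<bullet> y) * indicator ?A (y \<bullet> y) = 0" if "q < y \<bullet> y" for y
        using that by simp
    qed measurable
    then have "integrable lebesgue (\<lambda>y. \<Sum>e\<in>Basis. (g y \<bullet> e) * ((y \<bullet> e) / (y \<bullet> y) * indicator ?A (y \<bullet> y)))"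
      by (rule Bochner_Integration.integrable_sum)
    also have "(\<lambda>y. \<Sum>e\<in>Basis. (g y \<bullet> e) * ((y \<bullet> e) / (y \<bullet> y) * indicator ?A (y \<bullet> y))) = G"
    proof
      fix y
      show "(\<Sum>e\<in>Basis. (g y \<bullet> e) * ((y \<bullet> e) / (y \<bullet> y) * indicator ?A (y \<bullet> y))) = G y"
        unfolding G_def by (subst (3) euclidean_inner) (simp add: sum_distrib_left sum_divide_distrib sum_distrib_right mult_ac)
    qed
    finally show ?thesis .
  qed
  define W where "W x = (LINT y|lebesgue. G y * indicator {..x \<bullet> x} (y \<bullet> y))" for x :: "real^2"
  \<comment> \<open>The zero functions are admissible for \<eta> and \<psi>, and measurability is
    all that is wanted here.\<close>
  have Wm[measurable]: "W \<in> borel_measurable lebesgue"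
    unfolding W_def by (rule Fubini_radial_primitive(2)[OF Gi, of "\<lambda>_. 0" "\<lambda>_. 0" 0 0]) auto
  have Wb: "\<bar>W x\<bar> \<le> (LINT y|lebesgue. \<bar>G y\<bar>)" for x
  proof -
    have Gm: "G \<in> borel_measurable lebesgue" using Gi by simp
    have "integrable lebesgue (\<lambda>y. G y * indicator {..x \<bullet> x} (y \<bullet> y))"
      by (rule Bochner_Integration.integrable_bound[OF Gi]) (use Gm in measurable, auto simp: indicator_def)
    then have "\<bar>W x\<bar> \<le> (LINT y|lebesgue. \<bar>G y * indicator {..x \<bullet> x} (y \<bullet> y)\<bar>)"
      unfolding W_def using integral_norm_bound by fastforce
    also have "\<dots> \<le> (LINT y|lebesgue. \<bar>G y\<bar>)"
      by (rule integral_mono') (use Gi in \<open>auto simp: indicator_def\<close>)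
    finally show ?thesis .
  qed
  have uA: "integrable lebesgue (\<lambda>x. u x * indicator ?A (x \<bullet> x))"
    by (rule L1_loc_mult_integrable[OF u, where C = 1 and R = q]) (auto simp: indicator_def)
  have WA: "integrable lebesgue (\<lambda>x. W x * indicator ?A (x \<bullet> x))"
  proof (rule Bochner_Integration.integrable_bound)
    show "integrable lebesgue (\<lambda>x::real^2. (LINT y|lebesgue. \<bar>G y\<bar>) * indicator ?A (x \<bullet> x))"
      by (intro integrable_mult_right indicator_inner_self_integrable[of _ q]) auto
    show "AE x in lebesgue. norm (W x * indicator ?A (x \<bullet> x)) \<le> norm ((LINT y|lebesgue. \<bar>G y\<bar>) * indicator ?A (x \<bullet> x))"
      using Wb by (intro AE_I2) (auto simp: indicator_def intro: order_trans[OF _ abs_ge_self])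
  qed measurable
  define v where "v x = u x * indicator ?A (x \<bullet> x) - W x * indicator ?A (x \<bullet> x) / (2 * pi)" for x
  have "\<exists>c. AE x in lebesgue. x \<bullet> x \<in> ?A \<longrightarrow> v x = c"
  proof (rule radial_du_Bois_Reymond)
    show vi: "integrable lebesgue v" unfolding v_def using uA WA by simp
    show "AE x in lebesgue. v x = (\<lambda>r. f (sqrt r) * indicator ?A r
        - (LINT y|lebesgue. G y * indicator {..r} (y \<bullet> y)) * indicator ?A r / (2 * pi)) (x \<bullet> x)"
      using rad by eventually_elim (simp add: v_def W_def norm_eq_sqrt_inner)
    show "v x = 0" if "x \<bullet> x \<notin> ?A" for x using that by (simp add: v_def)
    show "0 \<le> p" "p < q" using p pq by auto
    fix \<psi> assume \<psi>: "smooth \<psi>" "\<And>x. x \<le> p \<or> q \<le> x \<Longrightarrow> \<psi> x = 0" "(LINT x|lborel. \<psi> x) = 0"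
    \<comment> \<open>Mean zero makes \<psi> the derivative of an admissible profile \<eta>, which
      links the pairing with \<open>u\<close> to the weak gradient.\<close>
    obtain \<eta> where \<eta>: "smooth \<eta>" "\<And>x. (\<eta> has_real_derivative \<psi> x) (at x)"
      "\<And>x. x \<le> p \<or> q \<le> x \<Longrightarrow> \<eta> x = 0"
      using smooth_antiderivative[OF \<psi>(1) _ \<psi>(2,3)] pq by (metis less_imp_le)
    have \<psi>c: "continuous_on UNIV \<psi>" by (rule smooth_continuous[OF \<psi>(1)])
    have [measurable]: "\<psi> \<in> borel_measurable borel"
      by (rule borel_measurable_continuous_onI[OF \<psi>c])
    obtain C where C: "\<And>x. \<bar>\<psi> x\<bar> \<le> C"
      using continuous_bounded_compact_support[OF \<psi>c \<psi>(2)] by blast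
    have \<psi>i: "integrable lebesgue (\<lambda>x. h x * \<psi> (x \<bullet> x))" if h: "integrable lebesgue h" for h :: "real^2 \<Rightarrow> real"
    proof (rule Bochner_Integration.integrable_bound[OF integrable_mult_right[OF h, of C]])
      have "h \<in> borel_measurable lebesgue" using h by simp
      then show "(\<lambda>x. h x * \<psi> (x \<bullet> x)) \<in> borel_measurable lebesgue" by measurable
      show "AE x in lebesgue. norm (h x * \<psi> (x \<bullet> x)) \<le> norm (C * h x)"
        using order_trans[OF C abs_ge_self]
        by (intro AE_I2) (simp add: abs_mult mult.commute[of C] mult.commute[of "\<bar>C\<bar>"] mult_left_mono)
    qed
    have \<psi>A: "\<psi> (x \<bullet> x) * indicator ?A (x \<bullet> x) = \<psi> (x \<bullet> x)" for x :: "real^2"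
      using \<psi>(2)[of "x \<bullet> x"] by (cases "x \<bullet> x \<in> ?A") auto
    have eq: "h x * indicator ?A (x \<bullet> x) * \<psi> (x \<bullet> x) = h x * \<psi> (x \<bullet> x)"
      for h and x :: "real^2"
      using \<psi>A[of x] by (metis mult.assoc mult.commute)
    have "(LINT x|lebesgue. \<psi> (x \<bullet> x) * v x) = (LINT x|lebesgue. u x * indicator ?A (x \<bullet> x) * \<psi> (x \<bullet> x)
        - W x * indicator ?A (x \<bullet> x) * \<psi> (x \<bullet> x) / (2 * pi))"
      by (rule Bochner_Integration.integral_cong) (simp_all add: v_def algebra_simps)
    also have "\<dots> = (LINT x|lebesgue. u x * \<psi> (x \<bullet> x)) - (LINT x|lebesgue. W x * \<psi> (x \<bullet> x)) / (2 * pi)"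
      using \<psi>i[OF uA] \<psi>i[OF WA] by (simp add: eq)
    also have "(LINT x|lebesgue. W x * \<psi> (x \<bullet> x)) = - pi * (LINT y|lebesgue. G y * \<eta> (y \<bullet> y))"
      unfolding W_def by (rule Fubini_radial_primitive(1)[OF Gi \<eta>(2) \<psi>c \<eta>(3) \<psi>(2)])
    also have "(\<lambda>y. G y * \<eta> (y \<bullet> y)) = (\<lambda>x. (g x \<bullet> x) / (x \<bullet> x) * \<eta> (x \<bullet> x))"
    proof
      show "G y * \<eta> (y \<bullet> y) = (g y \<bullet> y) / (y \<bullet> y) * \<eta> (y \<bullet> y)" for y
        using \<eta>(3)[of "y \<bullet> y"] by (cases "y \<bullet> y \<in> ?A") (auto simp: G_def)
    qed
    finally show "(LINT x|lebesgue. \<psi> (x \<bullet> x) * v x) = 0"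
      using weak_gradient_radial_test[where q = q, OF wg p \<eta>(1,2,3) \<psi>(2)] by simp
  qed
  then obtain c where "AE x in lebesgue. x \<bullet> x \<in> ?A \<longrightarrow> v x = c" by blast
  then have "AE x in lebesgue. x \<bullet> x \<in> ?A \<longrightarrow> u x = c + W x / (2 * pi)"
    by eventually_elim (auto simp: v_def)
  then show "\<exists>c. AE x in lebesgue. x \<bullet> x \<in> ?A \<longrightarrow>
      u x = c + (LINT y|lebesgue. G y * indicator {..x \<bullet> x} (y \<bullet> y)) / (2 * pi)"
    unfolding W_def by blast
qed

section \<open>Pointwise increments bounded by the gradient on an annulus\<close>

lemma integral_inverse_square_annulus:
  assumes "0 < a" "a \<le> b"
  shows "(LINT z|lebesgue. indicator {a<..b} ((z::real^2) \<bullet> z) / (z \<bullet> z)) = pi * ln (b / a)"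
    and "integrable lebesgue (\<lambda>z::real^2. indicator {a<..b} (z \<bullet> z) / (z \<bullet> z))"
proof -
  have "(LINT z|lebesgue. indicator {a<..b} ((z::real^2) \<bullet> z) / (z \<bullet> z))
     = pi * (LINT r|lborel. indicator {0..} r * (indicator {a<..b} r / r))"
    by (rule integral_radial) measurable
  also have "(LINT r|lborel. indicator {0..} r * (indicator {a<..b} r / r)) = (LINT r|lborel. 1 / r * indicator {a..b} r)"
  proof (rule integral_cong_AE)
    show "AE r in lborel. indicator {0..} r * (indicator {a<..b} r / r) = 1 / r * indicator {a..b} r"
      using AE_lborel_singleton[of a] by eventually_elim (use assms in \<open>auto simp: indicator_def\<close>)
  qed measurable
  also have "\<dots> = ln b - ln a"
    by (rule integral_FTC_Icc_real) (use assms in \<open>auto intro!: derivative_eq_intros continuous_intros\<close>)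
  finally show 1: "(LINT z|lebesgue. indicator {a<..b} ((z::real^2) \<bullet> z) / (z \<bullet> z)) = pi * ln (b / a)"
    using assms by (simp add: ln_div)
  show "integrable lebesgue (\<lambda>z::real^2. indicator {a<..b} (z \<bullet> z) / (z \<bullet> z))"
  proof (cases "a = b")
    case False
    show ?thesis
    proof (rule ccontr)
      \<comment> \<open>A non-integrable function has Bochner integral 0 by convention, whereas the
        value just computed is nonzero for a < b.\<close>
      assume "\<not> ?thesis"
      from not_integrable_integral_eq[OF this] 1 have "ln (b / a) = 0" by simp
      then show False using assms False by simp
    qed
  qed simp
qed

text \<open>The unknown constant cancels in a difference, leaving 2 pi (u y - u x) as the integral
  of (g \<bullet> z) / |z|^2 over the annulus between the two points. Cauchy-Schwarz splits the
  integrand into (g \<bullet> z) / |z| and 1 / |z|. A countable exhaustion of the punctured plane by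
  annuli allows one null set for all pairs of points.\<close>

lemma radial_weak_gradient_estimate:
  fixes u :: "real^2 \<Rightarrow> real"
  assumes wg: "has_weak_gradient u g" and rad: "AE x in lebesgue. u x = f (norm x)"
    and g2: "integrable lebesgue (\<lambda>x. (norm (g x))\<^sup>2)"
  shows "\<exists>N\<in>null_sets lebesgue. \<forall>x y. x \<notin> N \<longrightarrow> y \<notin> N \<longrightarrow> 0 < norm x \<longrightarrow> norm x \<le> norm y \<longrightarrow>
    (u x - u y)\<^sup>2 \<le> ln (norm y / norm x) / (2 * pi) *
       (LINT z|lebesgue. (norm (g z))\<^sup>2 * indicator {norm x<..norm y} (norm z))"
proof -
  \<comment> \<open>The annuli 1 / (n + 1) < |x|^2 < n + 2 exhaust the punctured plane; the extra 1
    in \<open>q\<close> keeps p < q already at n = 0.\<close>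
  define p where "p n = inverse (real (Suc n))" for n
  define q where "q n = real (Suc n) + 1" for n
  have pq: "0 < p n" "p n < q n" for n
  proof -
    have "inverse (real (Suc n)) \<le> 1" by (simp add: field_simps)
    then show "p n < q n" by (simp add: p_def q_def)
  qed (simp add: p_def)
  define G where "G n y = (g y \<bullet> y) / (y \<bullet> y) * indicator {p n<..<q n} (y \<bullet> y)" for n y
  have Gi: "integrable lebesgue (G n)" for n
    using radial_weak_gradient_annulus(1)[OF wg rad pq, of n] by (simp add: G_def[abs_def])
  have "\<forall>n. \<exists>c. AE x in lebesgue. x \<bullet> x \<in> {p n<..<q n} \<longrightarrow>
      u x = c + (LINT y|lebesgue. G n y * indicator {..x \<bullet> x} (y \<bullet> y)) / (2 * pi)"
    using radial_weak_gradient_annulus(2)[OF wg rad pq] by (simp add: G_def)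
  from choice[OF this] obtain c where "\<forall>n. AE x in lebesgue. x \<bullet> x \<in> {p n<..<q n} \<longrightarrow>
      u x = c n + (LINT y|lebesgue. G n y * indicator {..x \<bullet> x} (y \<bullet> y)) / (2 * pi)" ..
  then have "AE x in lebesgue. \<forall>n. x \<bullet> x \<in> {p n<..<q n} \<longrightarrow>
      u x = c n + (LINT y|lebesgue. G n y * indicator {..x \<bullet> x} (y \<bullet> y)) / (2 * pi)"
    by (simp add: AE_all_countable)
  then obtain N where N: "N \<in> null_sets lebesgue" "\<And>x n. x \<notin> N \<Longrightarrow> x \<bullet> x \<in> {p n<..<q n} \<Longrightarrow>
      u x = c n + (LINT y|lebesgue. G n y * indicator {..x \<bullet> x} (y \<bullet> y)) / (2 * pi)"
    unfolding eventually_ae_filter by auto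
  have gm: "g \<in> borel_measurable lebesgue"
    using wg by (simp add: has_weak_gradient_def L1_loc_def)
  show ?thesis
  proof (intro bexI[OF _ N(1)] allI impI)
    fix x y assume xy: "x \<notin> N" "y \<notin> N" "0 < norm x" "norm x \<le> norm y"
    let ?a = "x \<bullet> x" and ?b = "y \<bullet> y"
    have ab: "0 < ?a" "?a \<le> ?b"
      using xy by (auto simp: norm_le)
    obtain n1 where n1: "p n1 < ?a"
      using reals_Archimedean[OF ab(1)] by (auto simp: p_def)
    obtain n2 where n2: "?b < real n2" using reals_Archimedean2 by blast
    \<comment> \<open>Both points must lie in the same annulus, so that they share the constant
      \<open>c n\<close>.\<close>
    define n where "n = max n1 n2"
    have "p n \<le> p n1" "real n2 \<le> real n" by (auto simp: p_def n_def le_imp_inverse_le)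
    then have n: "p n < ?a" "?b < q n" using n1 n2 by (auto simp: q_def)
    let ?I = "\<lambda>z. indicator {?a<..?b} (z \<bullet> z) :: real"
    define F where "F z = (g z \<bullet> z) / norm z * ?I z" for z
    define h where "h z = ?I z / norm z" for z :: "real^2"
    have Gm: "G n \<in> borel_measurable lebesgue" using Gi by simp
    have Gi': "integrable lebesgue (\<lambda>z. G n z * indicator {..r} (z \<bullet> z))" for r
      by (rule Bochner_Integration.integrable_bound[OF Gi[of n]]) (use Gm in measurable, auto simp: indicator_def)
    have "2 * pi * (u y - u x) = (LINT z|lebesgue. G n z * indicator {..?b} (z \<bullet> z))
        - (LINT z|lebesgue. G n z * indicator {..?a} (z \<bullet> z))"
      using N(2)[OF xy(1), of n] N(2)[OF xy(2), of n] n ab by (simp add: field_simps)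
    also have "\<dots> = (LINT z|lebesgue. G n z * indicator {..?b} (z \<bullet> z) - G n z * indicator {..?a} (z \<bullet> z))"
      using Gi' by simp
    also have "\<dots> = (LINT z|lebesgue. F z * h z)"
    proof (rule Bochner_Integration.integral_cong)
      fix z
      show "G n z * indicator {..?b} (z \<bullet> z) - G n z * indicator {..?a} (z \<bullet> z) = F z * h z"
        using n ab by (auto simp: inner_ge_zero[THEN leD] G_def F_def h_def indicator_def power2_norm_eq_inner[symmetric] power2_eq_square)
    qed simp
    finally have eq: "2 * pi * (u y - u x) = (LINT z|lebesgue. F z * h z)" .
    have nm: "(\<lambda>z::real^2. norm z) \<in> borel_measurable lebesgue"
      by (rule measurable_completion) simp
    have im: "(\<lambda>z::real^2. z) \<in> borel_measurable lebesgue"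
      by (rule measurable_completion) simp
    have Fm: "F \<in> borel_measurable lebesgue" unfolding F_def using gm nm im by measurable
    have hm: "h \<in> borel_measurable lebesgue" unfolding h_def using nm by measurable
    have Fb: "(F z)\<^sup>2 \<le> (norm (g z))\<^sup>2 * ?I z" for z
    proof (cases "z \<bullet> z \<in> {?a<..?b}")
      case True
      then have "z \<bullet> z > 0" using ab by (auto intro: less_trans simp del: inner_gt_zero_iff)
      then have z: "norm z > 0" by simp
      have "\<bar>g z \<bullet> z\<bar> / norm z \<le> norm (g z)"
        using Cauchy_Schwarz_ineq2[of "g z" z] z by (simp add: field_simps)
      then have "(\<bar>g z \<bullet> z\<bar> / norm z)\<^sup>2 \<le> (norm (g z))\<^sup>2"
        by (rule power_mono) simp
      then show ?thesis using True by (simp add: F_def power_divide)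
    qed (simp add: F_def)
    have gI: "integrable lebesgue (\<lambda>z. (norm (g z))\<^sup>2 * ?I z)"
      by (rule Bochner_Integration.integrable_bound[OF g2]) (use gm in measurable, auto simp: indicator_def)
    have F2: "integrable lebesgue (\<lambda>z. (F z)\<^sup>2)"
      by (rule Bochner_Integration.integrable_bound[OF gI]) (use Fm in measurable, use Fb in \<open>auto intro: order_trans[OF _ abs_ge_self]\<close>)
    have h2: "(\<lambda>z. (h z)\<^sup>2) = (\<lambda>z. ?I z / (z \<bullet> z))"
    proof
      show "(h z)\<^sup>2 = ?I z / (z \<bullet> z)" for z
        by (cases "z \<bullet> z \<in> {?a<..?b}") (simp_all add: h_def power_divide power2_norm_eq_inner inner_ge_zero[THEN leD])
    qed
    have "(LINT z|lebesgue. F z * h z)\<^sup>2 \<le> (LINT z|lebesgue. (F z)\<^sup>2) * (LINT z|lebesgue. (h z)\<^sup>2)"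
      by (rule integral_Cauchy_Schwarz[OF Fm hm F2])
         (unfold h2, rule integral_inverse_square_annulus(2)[OF ab])
    also have "\<dots> \<le> (LINT z|lebesgue. (norm (g z))\<^sup>2 * ?I z) * (pi * ln (?b / ?a))"
    proof (rule mult_mono)
      show "(LINT z|lebesgue. (F z)\<^sup>2) \<le> (LINT z|lebesgue. (norm (g z))\<^sup>2 * ?I z)"
        by (rule integral_mono[OF F2 gI]) (rule Fb)
      show "(LINT z|lebesgue. (h z)\<^sup>2) \<le> pi * ln (?b / ?a)"
        unfolding h2 by (simp add: integral_inverse_square_annulus(1)[OF ab])
    qed (auto intro!: Bochner_Integration.integral_nonneg simp: indicator_def)
    also have "?b / ?a = (norm y / norm x)\<^sup>2"
      by (simp add: power_divide power2_norm_eq_inner)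
    also have "ln ((norm y / norm x)\<^sup>2) = 2 * ln (norm y / norm x)"
      using xy by (simp add: ln_realpow)
    also have "?I = (\<lambda>z. indicator {norm x<..norm y} (norm z))"
      by (auto simp: indicator_def fun_eq_iff norm_eq_sqrt_inner)
    finally have "(2 * pi * (u y - u x))\<^sup>2 \<le> (LINT z|lebesgue. (norm (g z))\<^sup>2 * indicator {norm x<..norm y} (norm z))
        * (pi * (2 * ln (norm y / norm x)))"
      unfolding eq .
    then show "(u x - u y)\<^sup>2 \<le> ln (norm y / norm x) / (2 * pi) *
       (LINT z|lebesgue. (norm (g z))\<^sup>2 * indicator {norm x<..norm y} (norm z))"
    proof -
      have "d\<^sup>2 \<le> l / (2 * pi) * j" if "(2 * pi * d)\<^sup>2 \<le> j * (pi * (2 * l))" for d l j :: real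
      proof -
        have "(2 * pi) * (2 * pi * d\<^sup>2) \<le> (2 * pi) * (l * j)"
          using that by (simp add: power2_eq_square mult_ac)
        then have "2 * pi * d\<^sup>2 \<le> l * j"
          by (rule mult_left_le_imp_le) simp
        then show ?thesis by (simp add: field_simps)
      qed
      then show ?thesis
        using \<open>(2 * pi * (u y - u x))\<^sup>2 \<le> _\<close> unfolding power2_commute[of "u x"] by blast
    qed
  qed
qed

section \<open>Exponential integrals\<close>

text \<open>Young's inequality for s = t + (s - t). A weight close to 1 on the increment is what
  preserves the constant 1 / (2 pi); the price is a large weight on the reference value, which only
  enters an additive constant.\<close>

lemma square_le_weighted:
  fixes s t \<epsilon> :: real
  assumes "0 < \<epsilon>"
  shows "s\<^sup>2 \<le> (1 + 1 / \<epsilon>) * t\<^sup>2 + (1 + \<epsilon>) * (s - t)\<^sup>2"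
proof -
  have "0 \<le> (t - \<epsilon> * (s - t))\<^sup>2 / \<epsilon>" using assms by simp
  also have "\<dots> = (1 + 1 / \<epsilon>) * t\<^sup>2 + (1 + \<epsilon>) * (s - t)\<^sup>2 - s\<^sup>2"
    using assms by (simp add: field_simps power2_eq_square)
  finally show ?thesis by simp
qed

text \<open>The asymptotic conditions speak about neighbourhoods of 0 and infinity; continuity on
  the compact interval in between extends the bound at 0 up to \<open>R\<close>. Beyond
  \<open>R\<close>, b < a (4 - \<mu>) / 4 means b \<sigma> < a, so the power of \<open>Q\<close> is
  dominated by r^a and hence by \<open>V\<close>.\<close>

lemma class_K_bounds:
  assumes \<mu>: "0 < \<mu>" "\<mu> < 2" and K: "class_K \<mu> V Q a\<^sub>0 a b\<^sub>0 b"
  defines "\<sigma> \<equiv> 4 / (4 - \<mu>)"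
  obtains R c C0 C1 where "1 \<le> R" "0 < c" "0 \<le> C0" "0 \<le> C1"
    "\<And>r. 0 < r \<Longrightarrow> r \<le> R \<Longrightarrow> Q r powr \<sigma> \<le> C0 * r powr (b\<^sub>0 * \<sigma>)"
    "\<And>r. R \<le> r \<Longrightarrow> Q r powr \<sigma> \<le> C1 * V r"
    "\<And>r. R \<le> r \<Longrightarrow> c * r powr a \<le> V r"
proof -
  have \<sigma>: "0 < \<sigma>" "b * \<sigma> < a"
    using \<mu> K by (auto simp: \<sigma>_def class_K_def field_simps)
  have Qpos: "\<And>r. 0 < r \<Longrightarrow> 0 < Q r" and Vpos: "\<And>r. 0 < r \<Longrightarrow> 0 < V r" and Qc: "continuous_on {0<..} Q"
    using K by (auto simp: class_K_def)
  have "Limsup (at_right 0) (\<lambda>r. ereal (Q r / r powr b\<^sub>0)) \<noteq> \<infinity>"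
    "Limsup at_top (\<lambda>r. ereal (Q r / r powr b)) \<noteq> \<infinity>"
    using K by (auto simp: class_K_def)
  then obtain n1 n2 :: nat where "Limsup (at_right 0) (\<lambda>r. ereal (Q r / r powr b\<^sub>0)) < ereal (real n1)"
    "Limsup at_top (\<lambda>r. ereal (Q r / r powr b)) < ereal (real n2)"
    by (auto simp: less_PInf_Ex_of_nat)
  from this[THEN Limsup_lessD] have
    ev1: "eventually (\<lambda>r. Q r / r powr b\<^sub>0 < real n1) (at_right 0)" and
    ev2: "eventually (\<lambda>r. Q r / r powr b < real n2) at_top"
    by simp_all
  have "0 < Liminf at_top (\<lambda>r. ereal (V r / r powr a))"
    using K by (simp add: class_K_def)
  from ereal_dense2[OF this] obtain c where c: "0 < ereal c" "ereal c < Liminf at_top (\<lambda>r. ereal (V r / r powr a))"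
    by blast
  from less_LiminfD[OF c(2)] have ev3: "eventually (\<lambda>r. c < V r / r powr a) at_top" by simp
  from ev1 obtain \<delta> where \<delta>: "0 < \<delta>" "\<And>r. 0 < r \<Longrightarrow> r < \<delta> \<Longrightarrow> Q r / r powr b\<^sub>0 < real n1"
    by (auto simp: eventually_at_right_field)
  from eventually_conj[OF ev2 ev3] obtain R0 where
    R0: "\<And>r. R0 \<le> r \<Longrightarrow> Q r / r powr b < real n2" "\<And>r. R0 \<le> r \<Longrightarrow> c < V r / r powr a"
    by (auto simp: eventually_at_top_linorder)
  \<comment> \<open>R \<ge> 1 makes powers of r \<ge> R monotone in the exponent.\<close>
  define R where "R = max 1 R0"
  have "bounded ((\<lambda>r. Q r / r powr b\<^sub>0) ` {\<delta> / 2..R})"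
    using \<delta>(1) by (intro compact_imp_bounded compact_continuous_image)
      (auto intro!: continuous_intros continuous_on_subset[OF Qc])
  then obtain m where mm: "\<forall>x\<in>(\<lambda>r. Q r / r powr b\<^sub>0) ` {\<delta> / 2..R}. norm x \<le> m"
    unfolding bounded_iff by blast
  then have m: "Q r / r powr b\<^sub>0 \<le> m" if "\<delta> / 2 \<le> r" "r \<le> R" for r
  proof -
    have "norm (Q r / r powr b\<^sub>0) \<le> m"
      by (rule bspec[OF mm imageI]) (use that in auto)
    then show ?thesis unfolding real_norm_def by (rule abs_le_D1)
  qed
  define C where "C = max m (real n1)"
  have C: "Q r \<le> C * r powr b\<^sub>0" if "0 < r" "r \<le> R" for r
  proof -
    have "Q r / r powr b\<^sub>0 \<le> C"
      using \<delta>(2)[of r] m[of r] \<delta>(1) that by (cases "r < \<delta>") (auto simp: C_def)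
    then show ?thesis using that by (simp add: field_simps)
  qed
  have "0 \<le> C" by (simp add: C_def le_max_iff_disj)
  show ?thesis
  proof (rule that[of R c "C powr \<sigma>" "real n2 powr \<sigma> / c"])
    show "1 \<le> R" "0 < c" "0 \<le> C powr \<sigma>" "0 \<le> real n2 powr \<sigma> / c"
      using c(1) by (auto simp: R_def)
    show "Q r powr \<sigma> \<le> C powr \<sigma> * r powr (b\<^sub>0 * \<sigma>)" if "0 < r" "r \<le> R" for r
    proof -
      have "Q r powr \<sigma> \<le> (C * r powr b\<^sub>0) powr \<sigma>"
        using C[OF that] \<sigma> Qpos[of r] that by (intro powr_mono2) auto
      then show ?thesis using \<open>0 \<le> C\<close> by (simp add: powr_mult powr_powr)
    qed
    show V: "c * r powr a \<le> V r" if "R \<le> r" for r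
    proof -
      have "0 < r" "R0 \<le> r" using that by (auto simp: R_def)
      then show ?thesis using R0(2)[of r] by (simp add: field_simps)
    qed
    show "Q r powr \<sigma> \<le> real n2 powr \<sigma> / c * V r" if "R \<le> r" for r
    proof -
      have r: "1 \<le> r" "R0 \<le> r" using that by (auto simp: R_def)
      then have "Q r \<le> real n2 * r powr b" using R0(1)[of r] by (simp add: field_simps)
      then have "Q r powr \<sigma> \<le> (real n2 * r powr b) powr \<sigma>"
        using \<sigma> Qpos[of r] r by (intro powr_mono2) auto
      also have "\<dots> = real n2 powr \<sigma> * r powr (b * \<sigma>)"
        by (simp add: powr_mult powr_powr)
      also have "\<dots> \<le> real n2 powr \<sigma> * r powr a"
        using \<sigma> r by (intro mult_left_mono powr_mono) auto
      also have "\<dots> = real n2 powr \<sigma> / c * (c * r powr a)"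
        using c by simp
      also have "\<dots> \<le> real n2 powr \<sigma> / c * V r"
        using V[OF that] c by (intro mult_left_mono) auto
      finally show ?thesis .
    qed
  qed
qed

lemma area_annulus:
  assumes "0 \<le> r"
  shows "(LINT x|lebesgue. indicator {r<..2 * r} (norm (x::real^2))) = 3 * pi * r\<^sup>2"
    and "integrable lebesgue (\<lambda>x::real^2. indicator {r<..2 * r} (norm x) :: real)"
proof -
  have eq: "indicator {r<..2 * r} (norm x) = (indicator {r\<^sup>2<..(2 * r)\<^sup>2} (x \<bullet> x) :: real)" for x :: "real^2"
  proof -
    have "r < norm x \<longleftrightarrow> r\<^sup>2 < x \<bullet> x"
      using assms by (metis norm_ge_zero power2_norm_eq_inner power_mono_iff not_le zero_less_numeral)
    moreover have "norm x \<le> 2 * r \<longleftrightarrow> x \<bullet> x \<le> (2 * r)\<^sup>2"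
      using assms by (simp add: norm_eq_sqrt_inner real_sqrt_le_iff' real_le_lsqrt sqrt_le_D)
    ultimately show ?thesis by (simp add: indicator_def)
  qed
  have "(LINT x|lebesgue. indicator {r\<^sup>2<..(2 * r)\<^sup>2} ((x::real^2) \<bullet> x) :: real)
      = pi * (LINT t|lborel. indicator {0..} t * indicator {r\<^sup>2<..(2 * r)\<^sup>2} t)"
    by (rule integral_radial) simp
  also have "(\<lambda>t. indicator {0..} t * indicator {r\<^sup>2<..(2 * r)\<^sup>2} t) = (indicator {r\<^sup>2<..(2 * r)\<^sup>2} :: real \<Rightarrow> real)"
  proof
    show "indicator {0..} t * indicator {r\<^sup>2<..(2 * r)\<^sup>2} t = (indicator {r\<^sup>2<..(2 * r)\<^sup>2} t :: real)" for t
      using order_trans[OF zero_le_power2[of r], of t] by (auto simp: indicator_def)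
  qed
  also have "(LINT t|lborel. indicator {r\<^sup>2<..(2 * r)\<^sup>2} t :: real) = 3 * r\<^sup>2"
    by (simp add: power_mult_distrib)
  finally show "(LINT x|lebesgue. indicator {r<..2 * r} (norm (x::real^2))) = 3 * pi * r\<^sup>2"
    by (simp add: eq)
  show "integrable lebesgue (\<lambda>x::real^2. indicator {r<..2 * r} (norm x) :: real)"
    unfolding eq by (rule indicator_inner_self_integrable[of _ "(2 * r)\<^sup>2"]) auto
qed

text \<open>Averaging over the annulus \<open>r < |y| \<le> 2r\<close>, on which \<open>V\<close> has mass at least a
  constant times \<open>r\<^bsup>a+2\<^esup>\<close>, replaces the usual decay lemma at infinity.\<close>

lemma exists_small_value_in_annulus:
  fixes u :: "real^2 \<Rightarrow> real"
  assumes V: "\<And>r. R \<le> r \<Longrightarrow> c * r powr a \<le> V r" and R: "1 \<le> R" and c: "0 < c" and a: "a > - 2"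
    and N: "N \<in> null_sets lebesgue"
    and Vpos: "\<And>r. 0 < r \<Longrightarrow> 0 < V r"
    and int: "integrable lebesgue (\<lambda>x. V (norm x) * (u x)\<^sup>2)"
    and M: "(LINT x|lebesgue. V (norm x) * (u x)\<^sup>2) \<le> M" and r: "R \<le> r"
  shows "\<exists>y. y \<notin> N \<and> r < norm y \<and> norm y \<le> 2 * r \<and> (u y)\<^sup>2 \<le> (M + 1) / (c * min 1 (2 powr a))"
proof (rule ccontr)
  \<comment> \<open>\<kappa> bounds the ratio of t^a to r^a from below for r < t \<le> 2 r, covering
    both signs of \<open>a\<close>.\<close>
  define \<kappa> where "\<kappa> = min 1 (2 powr a)"
  have \<kappa>: "0 < \<kappa>" by (simp add: \<kappa>_def)
  assume "\<not> ?thesis"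
  then have big: "(M + 1) / (c * \<kappa>) < (u y)\<^sup>2" if "y \<notin> N" "r < norm y" "norm y \<le> 2 * r" for y
    using that by (force simp: \<kappa>_def)
  have r1: "1 \<le> r" using R r by simp
  have V0: "AE x in lebesgue. V (norm x) * (u x)\<^sup>2 \<ge> 0"
  proof -
    have "AE x in lebesgue. x \<noteq> (0::real^2)" by (rule AE_completion) (rule AE_lborel_singleton)
    then show ?thesis by eventually_elim (simp add: Vpos less_imp_le)
  qed
  from integral_nonneg_AE[OF this] M have "0 \<le> M" by simp
  have lower: "\<kappa> * r powr a \<le> t powr a" if "r < t" "t \<le> 2 * r" for t
  proof (cases "a \<ge> 0")
    case True
    have "\<kappa> * r powr a \<le> 1 * r powr a" by (intro mult_right_mono) (auto simp: \<kappa>_def)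
    also have "\<dots> \<le> t powr a" using that r1 True by (simp add: powr_mono2)
    finally show ?thesis .
  next
    case False
    have "\<kappa> * r powr a \<le> 2 powr a * r powr a" by (intro mult_right_mono) (auto simp: \<kappa>_def)
    also have "\<dots> = (2 * r) powr a" using r1 by (simp add: powr_mult)
    also have "\<dots> \<le> t powr a" using that r1 False by (intro powr_mono2') auto
    finally show ?thesis .
  qed
  have "(M + 1) * (r powr a * (3 * pi * r\<^sup>2)) = (LINT x|lebesgue. (M + 1) * r powr a * indicator {r<..2 * r} (norm (x::real^2)))"
    using r1 by (simp add: area_annulus)
  also have "\<dots> \<le> (LINT x|lebesgue. V (norm x) * (u x)\<^sup>2)"
  proof (rule integral_mono_AE)
    show "integrable lebesgue (\<lambda>x::real^2. (M + 1) * r powr a * indicator {r<..2 * r} (norm x))"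
      using r1 by (intro integrable_mult_right area_annulus) simp
    show "AE x in lebesgue. (M + 1) * r powr a * indicator {r<..2 * r} (norm x) \<le> V (norm x) * (u x)\<^sup>2"
      using AE_not_in[OF N] V0
    proof eventually_elim
      case (elim x)
      show ?case
      proof (cases "r < norm x \<and> norm x \<le> 2 * r")
        case True
        have "(M + 1) * r powr a = (c * (\<kappa> * r powr a)) * ((M + 1) / (c * \<kappa>))"
          using c \<kappa> by simp
        also have "\<dots> \<le> V (norm x) * (u x)\<^sup>2"
        proof (rule mult_mono)
          show "c * (\<kappa> * r powr a) \<le> V (norm x)"
            using lower[of "norm x"] True c V[of "norm x"] r
            by (meson le_less_trans less_imp_le mult_left_mono order_trans)
          show "(M + 1) / (c * \<kappa>) \<le> (u x)\<^sup>2" using big[of x] elim True by auto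
          show "0 \<le> V (norm x)" using Vpos[of "norm x"] True r1 by linarith
          show "0 \<le> (M + 1) / (c * \<kappa>)" using c \<kappa> \<open>0 \<le> M\<close> by simp
        qed
        finally show ?thesis using True by simp
      qed (use elim in auto)
    qed
  qed (rule int)
  finally have "(M + 1) * (r powr a * (3 * pi * r\<^sup>2)) \<le> M" using M by simp
  \<comment> \<open>Since a > -2 and r \<ge> 1, the power r^(a+2) is at least 1, uniformly in
    \<open>r\<close>; with M + 1 in place of M the preceding inequality becomes
    contradictory.\<close>
  moreover have "1 \<le> r powr a * (3 * pi * r\<^sup>2)"
  proof -
    have "1 \<le> r powr (a + 2)" using r1 a by (intro ge_one_powr_ge_zero) auto
    also have "\<dots> = r powr a * r\<^sup>2" using r1 by (simp add: powr_add powr_numeral)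
    finally have 1: "1 \<le> r powr a * r\<^sup>2" .
    have "1 \<le> 3 * pi" using pi_gt3 by simp
    from mult_mono[OF this 1] show ?thesis by (simp add: mult_ac)
  qed
  then have "M + 1 \<le> (M + 1) * (r powr a * (3 * pi * r\<^sup>2))"
    using \<open>0 \<le> M\<close> by (intro mult_le_cancel_left1[THEN iffD2]) auto
  ultimately show False by simp
qed

text \<open>Inside radius \<open>R\<close> the logarithm in the bound on u^2 becomes the power
  |x|^(- \<alpha> \<beta>), so the integrand is at most a constant times (|x|^2)^s; in the squared
  radius this is a one-dimensional power integral, finite as s > -1. Outside, u^2 \<le> B linearises
  the exponential, and q \<le> C1 V leaves the integral of V u^2.\<close>

lemma exponential_integral_bound:
  fixes u :: "real^2 \<Rightarrow> real" and q V :: "real \<Rightarrow> real"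
  assumes \<alpha>: "0 < \<alpha>" and s: "s > - 1" "2 * s = \<gamma> - \<alpha> * \<beta>"
    and R: "0 < R" and C: "0 \<le> C0" "0 \<le> C1"
    and q0: "\<And>r. 0 < r \<Longrightarrow> r \<le> R \<Longrightarrow> q r \<le> C0 * r powr \<gamma>"
    and q1: "\<And>r. R \<le> r \<Longrightarrow> q r \<le> C1 * V r" and qpos: "\<And>r. 0 < r \<Longrightarrow> 0 \<le> q r"
    and Vpos: "\<And>r. 0 < r \<Longrightarrow> 0 < V r"
    and N: "N \<in> null_sets lebesgue"
    and int: "integrable lebesgue (\<lambda>x. V (norm x) * (u x)\<^sup>2)"
    and M: "(LINT x|lebesgue. V (norm x) * (u x)\<^sup>2) \<le> M"
    and u0: "\<And>x. x \<notin> N \<Longrightarrow> 0 < norm x \<Longrightarrow> norm x \<le> R \<Longrightarrow> (u x)\<^sup>2 \<le> A - \<beta> * ln (norm x)"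
    and u1: "\<And>x. x \<notin> N \<Longrightarrow> R \<le> norm x \<Longrightarrow> (u x)\<^sup>2 \<le> B"
  shows "(\<integral>\<^sup>+x. ennreal (q (norm x) * (exp (\<alpha> * (u x)\<^sup>2) - 1)) \<partial>lebesgue)
    \<le> ennreal (C0 * exp (\<alpha> * A)) * (ennreal pi * ennreal ((R\<^sup>2) powr (s + 1) / (s + 1)))
      + ennreal (C1 * (\<alpha> * exp (\<alpha> * B)) * M)"
proof -
  let ?f = "\<lambda>r. ennreal (r powr s * indicator {0..R\<^sup>2} r)"
  let ?k = "C1 * (\<alpha> * exp (\<alpha> * B))"
  have k: "0 \<le> ?k" using C \<alpha> by simp
  have ne: "AE x in lebesgue. x \<noteq> (0::real^2)" by (rule AE_completion) (rule AE_lborel_singleton)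
  have "(\<integral>\<^sup>+x. ennreal (q (norm x) * (exp (\<alpha> * (u x)\<^sup>2) - 1)) \<partial>lebesgue)
    \<le> (\<integral>\<^sup>+x. ennreal (C0 * exp (\<alpha> * A)) * ?f (x \<bullet> x) + ennreal (?k * (V (norm x) * (u x)\<^sup>2)) \<partial>lebesgue)"
  proof (rule nn_integral_mono_AE)
    show "AE x in lebesgue. ennreal (q (norm x) * (exp (\<alpha> * (u x)\<^sup>2) - 1))
      \<le> ennreal (C0 * exp (\<alpha> * A)) * ?f (x \<bullet> x) + ennreal (?k * (V (norm x) * (u x)\<^sup>2))"
      using ne AE_not_in[OF N]
    proof eventually_elim
      case (elim x)
      then have x: "0 < norm x" by simp
      show ?case
      proof (cases "norm x \<le> R")
        case True
        have "q (norm x) * (exp (\<alpha> * (u x)\<^sup>2) - 1) \<le> C0 * norm x powr \<gamma> * exp (\<alpha> * (A - \<beta> * ln (norm x)))"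
        proof (rule mult_mono)
          show "q (norm x) \<le> C0 * norm x powr \<gamma>" using q0 x True by simp
          have "exp (\<alpha> * (u x)\<^sup>2) \<le> exp (\<alpha> * (A - \<beta> * ln (norm x)))"
            using u0[OF elim(2) x True] \<alpha> by simp
          then show "exp (\<alpha> * (u x)\<^sup>2) - 1 \<le> exp (\<alpha> * (A - \<beta> * ln (norm x)))" by linarith
        qed (use C \<alpha> in auto)
        also have "\<dots> = C0 * exp (\<alpha> * A) * norm x powr (2 * s)"
        proof -
          have "exp (\<alpha> * (A - \<beta> * ln (norm x))) = exp (\<alpha> * A) * norm x powr (- (\<alpha> * \<beta>))"
            using x by (simp add: powr_def algebra_simps flip: exp_add)
          moreover have "norm x powr (2 * s) = norm x powr \<gamma> * norm x powr (- (\<alpha> * \<beta>))"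
            unfolding s(2) using x by (simp flip: powr_add)
          ultimately show ?thesis by simp
        qed
        also have "norm x powr (2 * s) = (x \<bullet> x) powr s"
          using x by (simp add: power2_norm_eq_inner[symmetric] powr_powr flip: powr_numeral)
        also have "\<dots> = (x \<bullet> x) powr s * indicator {0..R\<^sup>2} (x \<bullet> x)"
          using True R by (simp add: power2_norm_eq_inner[symmetric] power_mono)
        finally have "ennreal (q (norm x) * (exp (\<alpha> * (u x)\<^sup>2) - 1)) \<le> ennreal (C0 * exp (\<alpha> * A)) * ?f (x \<bullet> x)"
          using C by (subst ennreal_mult'[symmetric]) (auto intro!: ennreal_leI)
        then show ?thesis by (rule order_trans) simp
      next
        case False
        \<comment> \<open>With t = \<alpha> u^2 this is 1 - t \<le> exp(-t) multiplied by
          exp(t).\<close>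
        have "exp (\<alpha> * (u x)\<^sup>2) - 1 \<le> \<alpha> * (u x)\<^sup>2 * exp (\<alpha> * (u x)\<^sup>2)"
        proof -
          have "1 - \<alpha> * (u x)\<^sup>2 \<le> exp (- (\<alpha> * (u x)\<^sup>2))"
            using exp_ge_add_one_self[of "- (\<alpha> * (u x)\<^sup>2)"] by simp
          then have "(1 - \<alpha> * (u x)\<^sup>2) * exp (\<alpha> * (u x)\<^sup>2) \<le> exp (- (\<alpha> * (u x)\<^sup>2)) * exp (\<alpha> * (u x)\<^sup>2)"
            by (intro mult_right_mono) auto
          then show ?thesis by (simp add: algebra_simps flip: exp_add)
        qed
        also have "\<dots> \<le> \<alpha> * (u x)\<^sup>2 * exp (\<alpha> * B)"
          using u1[of x] elim False \<alpha> by (intro mult_left_mono) auto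
        finally have "q (norm x) * (exp (\<alpha> * (u x)\<^sup>2) - 1) \<le> (C1 * V (norm x)) * (\<alpha> * (u x)\<^sup>2 * exp (\<alpha> * B))"
          using q1[of "norm x"] False qpos[OF x] \<alpha> Vpos[OF x] C by (intro mult_mono) auto
        also have "\<dots> = ?k * (V (norm x) * (u x)\<^sup>2)" by simp
        finally have "ennreal (q (norm x) * (exp (\<alpha> * (u x)\<^sup>2) - 1)) \<le> ennreal (?k * (V (norm x) * (u x)\<^sup>2))"
          by (rule ennreal_leI)
        then show ?thesis by (rule order_trans) simp
      qed
    qed
  qed
  also have "\<dots> = (\<integral>\<^sup>+x. ennreal (C0 * exp (\<alpha> * A)) * ?f ((x::real^2) \<bullet> x) \<partial>lebesgue)
      + (\<integral>\<^sup>+x. ennreal (?k * (V (norm x) * (u x)\<^sup>2)) \<partial>lebesgue)"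
  proof (rule nn_integral_add)
    have "(\<lambda>x. V (norm x) * (u x)\<^sup>2) \<in> borel_measurable lebesgue" using int by simp
    then show "(\<lambda>x. ennreal (?k * (V (norm x) * (u x)\<^sup>2))) \<in> borel_measurable lebesgue" by measurable
  qed measurable
  also have "(\<integral>\<^sup>+x. ennreal (C0 * exp (\<alpha> * A)) * ?f ((x::real^2) \<bullet> x) \<partial>lebesgue)
    = ennreal (C0 * exp (\<alpha> * A)) * (\<integral>\<^sup>+x. ?f ((x::real^2) \<bullet> x) \<partial>lebesgue)"
    by (rule nn_integral_cmult) measurable
  also have "(\<integral>\<^sup>+x. ?f ((x::real^2) \<bullet> x) \<partial>lebesgue) = ennreal pi * (\<integral>\<^sup>+r. ?f r * indicator {0..} r \<partial>lborel)"
    by (rule nn_integral_radial) measurable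
  also have "(\<integral>\<^sup>+r. ?f r * indicator {0..} r \<partial>lborel) = (\<integral>\<^sup>+r. ennreal (indicator {0..R\<^sup>2} r * r powr s) \<partial>lborel)"
    by (rule nn_integral_cong) (auto simp: indicator_def)
  also have "\<dots> = ennreal ((R\<^sup>2) powr (s + 1) / (s + 1))"
    by (rule nn_integral_has_integral_lebesgue[OF _ has_integral_powr_from_0]) (use s in auto)
  also have "(\<integral>\<^sup>+x. ennreal (?k * (V (norm x) * (u x)\<^sup>2)) \<partial>lebesgue) = ennreal (LINT x|lebesgue. ?k * (V (norm x) * (u x)\<^sup>2))"
  proof (rule nn_integral_eq_integral)
    show "integrable lebesgue (\<lambda>x. ?k * (V (norm x) * (u x)\<^sup>2))"
      by (rule integrable_mult_right) (rule int)
    show "AE x in lebesgue. 0 \<le> ?k * (V (norm x) * (u x)\<^sup>2)"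
      using ne
    proof eventually_elim
      case (elim x)
      then have "0 < V (norm x)" using Vpos[of "norm x"] by simp
      then show ?case using C \<alpha> by simp
    qed
  qed
  also have "ennreal (LINT x|lebesgue. ?k * (V (norm x) * (u x)\<^sup>2)) \<le> ennreal (?k * M)"
    using k M by (intro ennreal_leI) (simp add: mult_left_mono del: mult_nonneg_nonneg)
  finally show ?thesis by (simp add: add_left_mono)
qed

text \<open>Each point is compared with a point y where u^2 \<le> K, taken from the annulus that
  starts at |x| if |x| \<ge> R and at \<open>R\<close> otherwise. The comparison costs log 2 in the
  first case and log(2 R / |x|) in the second.\<close>

lemma radial_pointwise_bounds:
  fixes u :: "real^2 \<Rightarrow> real"
  assumes V: "\<And>r. R \<le> r \<Longrightarrow> c * r powr a \<le> V r" and R: "1 \<le> R" and c: "0 < c" and a: "a > - 2"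
    and N: "N \<in> null_sets lebesgue"
    and Vpos: "\<And>r. 0 < r \<Longrightarrow> 0 < V r"
    and int: "integrable lebesgue (\<lambda>x. V (norm x) * (u x)\<^sup>2)"
    and M: "(LINT x|lebesgue. V (norm x) * (u x)\<^sup>2) \<le> M"
    and D: "0 \<le> D"
    and est: "\<And>x y. x \<notin> N \<Longrightarrow> y \<notin> N \<Longrightarrow> 0 < norm x \<Longrightarrow> norm x \<le> norm y \<Longrightarrow>
      (u x - u y)\<^sup>2 \<le> ln (norm y / norm x) / (2 * pi) * D"
    and x: "x \<notin> N" "0 < norm x"
  defines "K \<equiv> (M + 1) / (c * min 1 (2 powr a))"
  shows "R \<le> norm x \<Longrightarrow> (u x)\<^sup>2 \<le> 2 * K + ln 2 / pi * D"
    and "0 < \<epsilon> \<Longrightarrow> norm x \<le> R \<Longrightarrow>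
      (u x)\<^sup>2 \<le> (1 + 1 / \<epsilon>) * K + (1 + \<epsilon>) / (2 * pi) * D * (ln (2 * R) - ln (norm x))"
proof -
  have ann: "\<exists>y. y \<notin> N \<and> r < norm y \<and> norm y \<le> 2 * r \<and> (u y)\<^sup>2 \<le> K" if "R \<le> r" for r
    unfolding K_def by (rule exists_small_value_in_annulus[OF V R c a N Vpos int M that])
  have step: "(u x)\<^sup>2 \<le> (1 + 1 / \<epsilon>) * K + (1 + \<epsilon>) * (ln (t / norm x) / (2 * pi) * D)"
    if "0 < \<epsilon>" "y \<notin> N" "norm x \<le> norm y" "norm y \<le> t" "(u y)\<^sup>2 \<le> K" for \<epsilon> t and y :: "real^2"
  proof -
    have "(u x)\<^sup>2 \<le> (1 + 1 / \<epsilon>) * (u y)\<^sup>2 + (1 + \<epsilon>) * (u x - u y)\<^sup>2"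
      by (rule square_le_weighted) fact
    also have "\<dots> \<le> (1 + 1 / \<epsilon>) * K + (1 + \<epsilon>) * (ln (t / norm x) / (2 * pi) * D)"
    proof (intro add_mono mult_left_mono)
      have "(u x - u y)\<^sup>2 \<le> ln (norm y / norm x) / (2 * pi) * D"
        by (rule est) (use x that in auto)
      also have "\<dots> \<le> ln (t / norm x) / (2 * pi) * D"
        using x that D by (intro mult_right_mono divide_right_mono ln_mono divide_pos_pos) auto
      finally show "(u x - u y)\<^sup>2 \<le> ln (t / norm x) / (2 * pi) * D" .
    qed (use that in auto)
    finally show ?thesis .
  qed
  show "(u x)\<^sup>2 \<le> 2 * K + ln 2 / pi * D" if far: "R \<le> norm x"
  proof -
    obtain y where "y \<notin> N" "norm x < norm y" "norm y \<le> 2 * norm x" "(u y)\<^sup>2 \<le> K"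
      using ann[OF far] by blast
    \<comment> \<open>\<epsilon> = 1 suffices away from the origin, since the logarithm is bounded
      by log 2.\<close>
    from step[of 1 y "2 * norm x"] this show ?thesis using x by simp
  qed
  show "(u x)\<^sup>2 \<le> (1 + 1 / \<epsilon>) * K + (1 + \<epsilon>) / (2 * pi) * D * (ln (2 * R) - ln (norm x))"
    if "0 < \<epsilon>" "norm x \<le> R"
  proof -
    obtain y where "y \<notin> N" "R < norm y" "norm y \<le> 2 * R" "(u y)\<^sup>2 \<le> K"
      using ann[of R] by blast
    with step[of \<epsilon> y "2 * R"] that
    have "(u x)\<^sup>2 \<le> (1 + 1 / \<epsilon>) * K + (1 + \<epsilon>) * (ln (2 * R / norm x) / (2 * pi) * D)" by simp
    also have "ln (2 * R / norm x) = ln (2 * R) - ln (norm x)"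
      using x R by (subst ln_div) auto
    finally show ?thesis by (simp add: field_simps)
  qed
qed

lemma space_Y_radE:
  assumes "u \<in> space_Y_rad V"
  obtains N where "N \<in> null_sets lebesgue"
    "\<And>x y. x \<notin> N \<Longrightarrow> y \<notin> N \<Longrightarrow> 0 < norm x \<Longrightarrow> norm x \<le> norm y \<Longrightarrow>
      (u x - u y)\<^sup>2 \<le> ln (norm y / norm x) / (2 * pi) *
       (LINT z|lebesgue. (norm (weak_grad u z))\<^sup>2 * indicator {norm x<..norm y} (norm z))"
proof -
  from assms obtain f where f: "AE x in lebesgue. u x = f (norm x)" and u: "u \<in> space_Y V"
    by (auto simp: space_Y_rad_def)
  have "\<exists>g. has_weak_gradient u g" using u by (simp add: space_Y_def)
  then have "has_weak_gradient u (weak_grad u)" unfolding weak_grad_def by (rule someI_ex)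
  from radial_weak_gradient_estimate[OF this f] u that show ?thesis
    by (auto simp: space_Y_def)
qed

section \<open>Gradient mass near the origin and measurability of the integrand\<close>

lemma norm_measurable_lebesgue: "(\<lambda>x::'a::euclidean_space. norm x) \<in> borel_measurable lebesgue"
  by (rule measurable_completion) simp

lemma integral_indicator_norm_le:
  assumes g: "integrable lebesgue (\<lambda>z::'a::euclidean_space. (norm (g z))\<^sup>2)"
    and B: "B \<subseteq> B'" "B' \<in> sets borel"
  shows "(LINT z|lebesgue. (norm (g z))\<^sup>2 * indicator B (norm z))
    \<le> (LINT z|lebesgue. (norm (g z))\<^sup>2 * indicator B' (norm z))"
proof (rule integral_mono')
  have [measurable]: "(\<lambda>z. (norm (g z))\<^sup>2) \<in> borel_measurable lebesgue" using g by simp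
  note norm_measurable_lebesgue[measurable]
  show "integrable lebesgue (\<lambda>z. (norm (g z))\<^sup>2 * indicator B' (norm z))"
  proof (rule Bochner_Integration.integrable_bound[OF g])
    show "(\<lambda>z. (norm (g z))\<^sup>2 * indicator B' (norm z)) \<in> borel_measurable lebesgue"
      using B(2) by measurable
  qed (auto simp: indicator_def)
qed (use B in \<open>auto simp: indicator_def\<close>)

text \<open>For one fixed function the gradient mass in small discs is as small as desired; this is
  what admits every \<alpha> > 0 in the first claim of the theorem.\<close>

lemma integral_small_balls_tendsto_0:
  assumes g: "integrable lebesgue (\<lambda>z::'a::euclidean_space. (norm (g z))\<^sup>2)"
  shows "(\<lambda>n. LINT z|lebesgue. (norm (g z))\<^sup>2 * indicator {..inverse (real (Suc n))} (norm z)) \<longlonglongrightarrow> 0"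
proof -
  have [measurable]: "(\<lambda>z. (norm (g z))\<^sup>2) \<in> borel_measurable lebesgue" using g by simp
  note norm_measurable_lebesgue[measurable]
  have "(\<lambda>n. LINT z|lebesgue. (norm (g z))\<^sup>2 * indicator {..inverse (real (Suc n))} (norm z))
      \<longlonglongrightarrow> (LINT z::'a|lebesgue. 0)"
  proof (rule integral_dominated_convergence[OF _ _ g])
    have "AE x in lebesgue. x \<noteq> (0::'a)" by (rule AE_completion) (rule AE_lborel_singleton)
    then show "AE z in lebesgue. (\<lambda>n. (norm (g z))\<^sup>2 * indicator {..inverse (real (Suc n))} (norm z)) \<longlonglongrightarrow> 0"
    proof eventually_elim
      case (elim z)
      have "eventually (\<lambda>n. inverse (real (Suc n)) < norm z) sequentially"
        by (rule order_tendstoD(2)[OF LIMSEQ_inverse_real_of_nat]) (use elim in simp)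
      then have "eventually (\<lambda>n. (norm (g z))\<^sup>2 * indicator {..inverse (real (Suc n))} (norm z) = 0) sequentially"
        by eventually_elim simp
      then show ?case by (rule tendsto_eventually)
    qed
    show "(\<lambda>z. (norm (g z))\<^sup>2 * indicator {..inverse (real (Suc n))} (norm z)) \<in> borel_measurable lebesgue" for n
      by measurable
  qed (auto simp: indicator_def)
  then show ?thesis by simp
qed

lemma weighted_exponential_measurable:
  fixes u :: "real^2 \<Rightarrow> real"
  assumes Q: "continuous_on {0<..} Q" and u: "u \<in> borel_measurable lebesgue"
  shows "(\<lambda>x. Q (norm x) powr \<sigma> * (exp (\<alpha> * (u x)\<^sup>2) - 1)) \<in> borel_measurable lebesgue"
proof -
  have [measurable]: "(\<lambda>r. indicator {0<..} r *\<^sub>R Q r) \<in> borel_measurable borel"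
    by (rule borel_measurable_continuous_on_indicator[OF _ Q]) simp
  note norm_measurable_lebesgue[measurable]
  \<comment> \<open>Continuity of \<open>Q\<close> is given on (0, \<infinity>), so the value at the
    origin is split off.\<close>
  have "(\<lambda>x::real^2. if norm x = 0 then Q 0 else indicator {0<..} (norm x) *\<^sub>R Q (norm x)) \<in> borel_measurable lebesgue"
    by measurable
  also have "(\<lambda>x::real^2. if norm x = 0 then Q 0 else indicator {0<..} (norm x) *\<^sub>R Q (norm x)) = (\<lambda>x. Q (norm x))"
    by auto
  finally show ?thesis using u by measurable
qed

theorem proposition2p9:
  fixes \<mu> a\<^sub>0 a b\<^sub>0 b :: real and V Q :: "real \<Rightarrow> real"
  assumes "0 < \<mu>" and "\<mu> < 2"
    and "class_K \<mu> V Q a\<^sub>0 a b\<^sub>0 b"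
  shows "(\<forall>u \<in> space_Y_rad V. \<forall>\<alpha>::real. \<alpha> > 0 \<longrightarrow>
            integrable lebesgue
              (\<lambda>x. Q (norm x) powr (4 / (4 - \<mu>)) * (exp (\<alpha> * (u x)\<^sup>2) - 1)))
       \<and> (\<forall>\<alpha>::real. 0 < \<alpha> \<and> \<alpha> < 4 * pi * (1 + 2 * b\<^sub>0 / (4 - \<mu>)) \<longrightarrow>
            (SUP u \<in> {u \<in> space_Y_rad V. norm_Y V u \<le> 1}.
               \<integral>\<^sup>+x. ennreal (Q (norm x) powr (4 / (4 - \<mu>)) * (exp (\<alpha> * (u x)\<^sup>2) - 1)) \<partial>lebesgue)
              < \<infinity>)"
proof -
  define \<sigma> where "\<sigma> = 4 / (4 - \<mu>)"
  \<comment> \<open>Near the origin the power of \<open>Q\<close> is at most a constant times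
    |x|^\<gamma>, and b0 > - (4 - \<mu>) / 2 says exactly \<gamma> > -2, local integrability of
    |x|^\<gamma> in the plane.\<close>
  define \<gamma> where "\<gamma> = b\<^sub>0 * \<sigma>"
  have a: "a > - 2" and Vpos: "\<And>r. 0 < r \<Longrightarrow> 0 < V r" and Qc: "continuous_on {0<..} Q"
    and b0: "b\<^sub>0 > - ((4 - \<mu>) / 2)"
    using assms(3) by (auto simp: class_K_def)
  have \<gamma>: "\<gamma> > - 2" using b0 assms(1,2) by (simp add: \<gamma>_def \<sigma>_def field_simps)
  obtain R c C0 C1 where R: "1 \<le> R" and c: "0 < c" and C: "0 \<le> C0" "0 \<le> C1"
    and q0: "\<And>r. 0 < r \<Longrightarrow> r \<le> R \<Longrightarrow> Q r powr \<sigma> \<le> C0 * r powr \<gamma>"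
    and q1: "\<And>r. R \<le> r \<Longrightarrow> Q r powr \<sigma> \<le> C1 * V r"
    and V: "\<And>r. R \<le> r \<Longrightarrow> c * r powr a \<le> V r"
    using class_K_bounds[OF assms] unfolding \<sigma>_def \<gamma>_def by blast
  define K where "K M = (M + 1) / (c * min 1 (2 powr a))" for M
  have R0: "0 < R" using R by simp
  have gi: "integrable lebesgue (\<lambda>x. (norm (weak_grad u x))\<^sup>2)"
    and Vi: "integrable lebesgue (\<lambda>x. V (norm x) * (u x)\<^sup>2)"
    and um: "u \<in> borel_measurable lebesgue"
    if "u \<in> space_Y_rad V" for u
    using that by (auto simp: space_Y_rad_def space_Y_def L2_loc_def)
  \<comment> \<open>Enlarging the annulus to a fixed set \<open>B\<close> of radii makes the
    constant independent of the pair of points: all radii give the total mass, radii up to \<rho>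
    the mass of a small disc.\<close>
  have est_total: "(u x - u y)\<^sup>2 \<le> ln (norm y / norm x) / (2 * pi) * D"
    if u: "u \<in> space_Y_rad V" and "0 < norm x" "norm x \<le> norm y"
      and e: "(u x - u y)\<^sup>2 \<le> ln (norm y / norm x) / (2 * pi) *
       (LINT z|lebesgue. (norm (weak_grad u z))\<^sup>2 * indicator {norm x<..norm y} (norm z))"
      and D: "(LINT z|lebesgue. (norm (weak_grad u z))\<^sup>2 * indicator B (norm z)) \<le> D"
      and B: "{norm x<..norm y} \<subseteq> B" "B \<in> sets borel"
    for u x y D B
  proof -
    have "0 \<le> ln (norm y / norm x) / (2 * pi)" using that(2,3) by (simp add: field_simps)
    then show ?thesis
      using e order_trans[OF integral_indicator_norm_le[OF gi[OF u] B] D]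
      by (meson mult_left_mono order_trans)
  qed
  have "integrable lebesgue (\<lambda>x. Q (norm x) powr \<sigma> * (exp (\<alpha> * (u x)\<^sup>2) - 1))"
    if u: "u \<in> space_Y_rad V" and \<alpha>: "0 < \<alpha>" for u \<alpha>
  proof -
    obtain N where N: "N \<in> null_sets lebesgue" and
      e: "\<And>x y. x \<notin> N \<Longrightarrow> y \<notin> N \<Longrightarrow> 0 < norm x \<Longrightarrow> norm x \<le> norm y \<Longrightarrow>
      (u x - u y)\<^sup>2 \<le> ln (norm y / norm x) / (2 * pi) *
       (LINT z|lebesgue. (norm (weak_grad u z))\<^sup>2 * indicator {norm x<..norm y} (norm z))"
      using space_Y_radE[OF u] by blast
    define D where "D = (LINT z|lebesgue. (norm (weak_grad u z))\<^sup>2)"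
    define M where "M = (LINT x|lebesgue. V (norm x) * (u x)\<^sup>2)"
    have D0: "0 \<le> D" by (simp add: D_def)
    have eD: "(u x - u y)\<^sup>2 \<le> ln (norm y / norm x) / (2 * pi) * D"
      if "x \<notin> N" "y \<notin> N" "0 < norm x" "norm x \<le> norm y" for x y
      by (rule est_total[OF u that(3,4) e[OF that], of UNIV]) (auto simp: D_def)
    have "\<forall>\<^sub>F n in sequentially. (LINT z|lebesgue. (norm (weak_grad u z))\<^sup>2
        * indicator {..inverse (real (Suc n))} (norm z)) < (\<gamma> + 2) * pi / \<alpha>"
      by (rule order_tendstoD(2)[OF integral_small_balls_tendsto_0[OF gi[OF u]]]) (use \<alpha> \<gamma> in simp)
    \<comment> \<open>The threshold is chosen so that \<beta> = D' / pi gives \<alpha> \<beta> <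
      \<gamma> + 2.\<close>
    then obtain n where n: "(LINT z|lebesgue. (norm (weak_grad u z))\<^sup>2
        * indicator {..inverse (real (Suc n))} (norm z)) < (\<gamma> + 2) * pi / \<alpha>"
      by (auto simp: eventually_sequentially)
    define \<rho> where "\<rho> = inverse (real (Suc n))"
    define D' where "D' = (LINT z|lebesgue. (norm (weak_grad u z))\<^sup>2 * indicator {..\<rho>} (norm z))"
    \<comment> \<open>Comparison with both weights equal to 2 turns D' / (2 pi) into D' / pi; the
      loss does not matter because D' is already small.\<close>
    define \<beta> where "\<beta> = D' / pi"
    have D': "0 \<le> D'" by (simp add: D'_def)
    have "\<alpha> * \<beta> < \<gamma> + 2"
    proof -
      have "D' < (\<gamma> + 2) * pi / \<alpha>" using n unfolding D'_def \<rho>_def .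
      then show ?thesis using \<alpha> by (simp add: \<beta>_def field_simps)
    qed
    have \<rho>: "0 < \<rho>" "\<rho> \<le> 1" by (auto simp: \<rho>_def field_simps)
    \<comment> \<open>A reference point in the small disc at which the estimate is valid; it exists
      because a disc of positive area is not null.\<close>
    obtain y where y: "y \<notin> N" "0 < norm y" "norm y \<le> \<rho>"
    proof -
      have "\<not> cball 0 \<rho> \<subseteq> insert 0 N"
      proof
        assume sub: "cball 0 \<rho> \<subseteq> insert 0 N"
        have "{0} \<union> N \<in> null_sets lebesgue"
          using N by (intro null_sets.Un) (auto intro!: null_sets_completionI simp: null_sets_def)
        with sub have "cball (0::real^2) \<rho> \<in> null_sets lebesgue"
          using null_sets_completion_subset[of "cball 0 \<rho>" "{0} \<union> N" lborel] by simp
        then have "emeasure lborel (cball (0::real^2) \<rho>) = 0"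
          by (simp add: null_sets_completion_iff null_sets_def)
        then show False using \<rho> by (simp add: emeasure_cball unit_ball_vol_2)
      qed
      then obtain z where "z \<in> cball 0 \<rho>" "z \<notin> insert 0 N" by blast
      then show thesis using that[of z] by auto
    qed
    define B' where "B' = 2 * K M + D / pi * (ln (2 * R) - ln (norm y))"
    \<comment> \<open>The two entries serve |x| \<le> |y|, where \<open>u y\<close> is the reference
      value, and |y| < |x| \<le> R, where \<open>B'\<close> bounds u^2; adding \<beta> ln R
      compensates for - \<beta> ln |x| on the second range.\<close>
    define A where "A = max (2 * (u y)\<^sup>2 + \<beta> * ln (norm y)) (B' + \<beta> * ln R)"
    have bound0: "(u x)\<^sup>2 \<le> A - \<beta> * ln (norm x)" if x: "x \<notin> N" "0 < norm x" "norm x \<le> R" for x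
    proof (cases "norm x \<le> norm y")
      case True
      have "(u x - u y)\<^sup>2 \<le> ln (norm y / norm x) / (2 * pi) * D'"
        by (rule est_total[OF u x(2) True e[OF x(1) y(1) x(2) True], of "{..\<rho>}"])
           (use y in \<open>auto simp: D'_def\<close>)
      also have "ln (norm y / norm x) / (2 * pi) * D' = \<beta> / 2 * (ln (norm y) - ln (norm x))"
        using x y by (simp add: ln_div \<beta>_def mult_ac)
      finally have "(u x)\<^sup>2 \<le> 2 * (u y)\<^sup>2 + 2 * (\<beta> / 2 * (ln (norm y) - ln (norm x)))"
        using square_le_weighted[of 1 "u x" "u y"] by simp
      then have "(u x)\<^sup>2 \<le> 2 * (u y)\<^sup>2 + \<beta> * ln (norm y) - \<beta> * ln (norm x)"
        by (simp add: algebra_simps)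
      then show ?thesis by (simp add: A_def)
    next
      case False
      have "(u x)\<^sup>2 \<le> 2 * K M + D / pi * (ln (2 * R) - ln (norm x))"
        using radial_pointwise_bounds(2)[OF V R c a N Vpos Vi[OF u] _ D0 eD x(1,2) _ x(3), of M 1]
        by (simp add: M_def K_def)
      also have "\<dots> \<le> B'"
      proof -
        have "ln (norm y) \<le> ln (norm x)" using False y(2) by (intro ln_mono) linarith+
        then show ?thesis
          unfolding B'_def using D0 by (intro add_left_mono mult_left_mono) auto
      qed
      also have "B' \<le> B' + \<beta> * ln R - \<beta> * ln (norm x)"
      proof -
        have "ln (norm x) \<le> ln R" using x R by (intro ln_mono) linarith+
        moreover have "0 \<le> \<beta>" using D' by (simp add: \<beta>_def)
        ultimately have "\<beta> * ln (norm x) \<le> \<beta> * ln R" by (rule mult_left_mono)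
        then show ?thesis by linarith
      qed
      finally show ?thesis by (simp add: A_def)
    qed
    have bound1: "(u x)\<^sup>2 \<le> 2 * K M + ln 2 / pi * D" if "x \<notin> N" "R \<le> norm x" for x
    proof -
      have x0: "0 < norm x" using that R by linarith
      show ?thesis
        using radial_pointwise_bounds(1)[OF V R c a N Vpos Vi[OF u] _ D0 eD that(1) x0 that(2), of M]
        by (simp add: M_def K_def)
    qed
    have "(\<integral>\<^sup>+x. ennreal (Q (norm x) powr \<sigma> * (exp (\<alpha> * (u x)\<^sup>2) - 1)) \<partial>lebesgue)
      \<le> ennreal (C0 * exp (\<alpha> * A)) * (ennreal pi * ennreal ((R\<^sup>2) powr ((\<gamma> - \<alpha> * \<beta>) / 2 + 1) / ((\<gamma> - \<alpha> * \<beta>) / 2 + 1)))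
        + ennreal (C1 * (\<alpha> * exp (\<alpha> * (2 * K M + ln 2 / pi * D))) * M)"
      by (rule exponential_integral_bound[where N = N and V = V and \<gamma> = \<gamma> and \<beta> = \<beta>])
         (use \<alpha> \<open>\<alpha> * \<beta> < \<gamma> + 2\<close> R0 C q0 q1 Vpos N Vi[OF u] bound0 bound1 in \<open>auto simp: M_def\<close>)
    also have "\<dots> < \<infinity>" by (simp add: ennreal_mult_less_top)
    finally show ?thesis
      by (intro integrableI_nonneg weighted_exponential_measurable Qc um[OF u]) (use \<alpha> in auto)
  qed
  moreover have "(SUP u \<in> {u \<in> space_Y_rad V. norm_Y V u \<le> 1}.
      \<integral>\<^sup>+x. ennreal (Q (norm x) powr \<sigma> * (exp (\<alpha> * (u x)\<^sup>2) - 1)) \<partial>lebesgue) < \<infinity>"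
    if \<alpha>: "0 < \<alpha>" "\<alpha> < 4 * pi * (1 + 2 * b\<^sub>0 / (4 - \<mu>))" for \<alpha>
  proof -
    \<comment> \<open>\<tau> > 1 is the ratio of the critical value to \<alpha>; \<epsilon> takes
      half of the margin, so that 1 + \<epsilon> < \<tau> and \<beta> stays subcritical.\<close>
    define \<tau> where "\<tau> = (\<gamma> + 2) * (2 * pi) / \<alpha>"
    define \<epsilon> where "\<epsilon> = (\<tau> - 1) / 2"
    define \<beta> where "\<beta> = (1 + \<epsilon>) / (2 * pi)"
    have "4 * pi * (1 + 2 * b\<^sub>0 / (4 - \<mu>)) = (\<gamma> + 2) * (2 * pi)"
      using assms(2) by (simp add: \<gamma>_def \<sigma>_def field_simps)
    with \<alpha>(2) have "\<alpha> < (\<gamma> + 2) * (2 * pi)" by (simp only:)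
    then have \<tau>: "1 < \<tau>" using \<alpha> by (simp add: \<tau>_def)
    then have \<epsilon>: "0 < \<epsilon>" by (simp add: \<epsilon>_def)
    have "\<alpha> * \<beta> < \<gamma> + 2"
    proof -
      have "1 + \<epsilon> < \<tau>" using \<tau> by (simp add: \<epsilon>_def field_simps)
      then have "\<alpha> * (1 + \<epsilon>) < (\<gamma> + 2) * (2 * pi)"
        using \<alpha> by (simp add: \<tau>_def field_simps)
      then show ?thesis by (simp add: \<beta>_def field_simps)
    qed
    define A where "A = (1 + 1 / \<epsilon>) * K 1 + \<beta> * ln (2 * R)"
    define B where "B = 2 * K 1 + ln 2 / pi"
    \<comment> \<open>The constants come from the weights, their exponents and \<alpha> alone, never
      from \<open>u\<close>; this is the uniformity.\<close>
    define bnd where "bnd = ennreal (C0 * exp (\<alpha> * A)) * (ennreal pi * ennreal ((R\<^sup>2) powr ((\<gamma> - \<alpha> * \<beta>) / 2 + 1) / ((\<gamma> - \<alpha> * \<beta>) / 2 + 1)))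
        + ennreal (C1 * (\<alpha> * exp (\<alpha> * B)) * 1)"
    have "(\<integral>\<^sup>+x. ennreal (Q (norm x) powr \<sigma> * (exp (\<alpha> * (u x)\<^sup>2) - 1)) \<partial>lebesgue) \<le> bnd"
      if u: "u \<in> space_Y_rad V" and norm: "norm_Y V u \<le> 1" for u
    proof -
      obtain N where N: "N \<in> null_sets lebesgue" and
        e: "\<And>x y. x \<notin> N \<Longrightarrow> y \<notin> N \<Longrightarrow> 0 < norm x \<Longrightarrow> norm x \<le> norm y \<Longrightarrow>
        (u x - u y)\<^sup>2 \<le> ln (norm y / norm x) / (2 * pi) *
         (LINT z|lebesgue. (norm (weak_grad u z))\<^sup>2 * indicator {norm x<..norm y} (norm z))"
        using space_Y_radE[OF u] by blast
      \<comment> \<open>Both parts of the squared norm are nonnegative, so each is at most 1, which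
        allows D = M = 1.\<close>
      have "(LINT z|lebesgue. (norm (weak_grad u z))\<^sup>2) + (LINT x|lebesgue. V (norm x) * (u x)\<^sup>2) \<le> 1"
        using norm gi[OF u] Vi[OF u] by (simp add: norm_Y_def)
      moreover have "0 \<le> (LINT x|lebesgue. V (norm x) * (u x)\<^sup>2)"
      proof (rule integral_nonneg_AE)
        have "AE x in lebesgue. x \<noteq> (0::real^2)" by (rule AE_completion) (rule AE_lborel_singleton)
        then show "AE x in lebesgue. 0 \<le> V (norm x) * (u x)\<^sup>2"
          by eventually_elim (simp add: Vpos less_imp_le)
      qed
      moreover have "0 \<le> (LINT z|lebesgue. (norm (weak_grad u z))\<^sup>2)" by simp
      ultimately have D: "(LINT z|lebesgue. (norm (weak_grad u z))\<^sup>2) \<le> 1"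
        and M: "(LINT x|lebesgue. V (norm x) * (u x)\<^sup>2) \<le> 1" by linarith+
      have eD: "(u x - u y)\<^sup>2 \<le> ln (norm y / norm x) / (2 * pi) * 1"
        if "x \<notin> N" "y \<notin> N" "0 < norm x" "norm x \<le> norm y" for x y
        by (rule est_total[OF u that(3,4) e[OF that], of UNIV]) (use D in auto)
      have bound0: "(u x)\<^sup>2 \<le> A - \<beta> * ln (norm x)" if x: "x \<notin> N" "0 < norm x" "norm x \<le> R" for x
        using radial_pointwise_bounds(2)[OF V R c a N Vpos Vi[OF u] M zero_le_one eD x(1,2) \<epsilon> x(3)]
        by (simp add: K_def A_def \<beta>_def algebra_simps)
      have bound1: "(u x)\<^sup>2 \<le> B" if "x \<notin> N" "R \<le> norm x" for x
      proof -
        have x0: "0 < norm x" using that R by linarith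
        show ?thesis
          using radial_pointwise_bounds(1)[OF V R c a N Vpos Vi[OF u] M zero_le_one eD that(1) x0 that(2)]
          by (simp add: K_def B_def)
      qed
      show ?thesis unfolding bnd_def
        by (rule exponential_integral_bound[where N = N and V = V and \<gamma> = \<gamma> and \<beta> = \<beta>])
           (use \<alpha> \<open>\<alpha> * \<beta> < \<gamma> + 2\<close> R0 C q0 q1 Vpos N Vi[OF u] M bound0 bound1 in auto)
    qed
    then have "(SUP u \<in> {u \<in> space_Y_rad V. norm_Y V u \<le> 1}.
      \<integral>\<^sup>+x. ennreal (Q (norm x) powr \<sigma> * (exp (\<alpha> * (u x)\<^sup>2) - 1)) \<partial>lebesgue) \<le> bnd"
      by (intro SUP_least) auto
    also have "bnd < \<infinity>" by (simp add: bnd_def ennreal_mult_less_top)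
    finally show ?thesis .
  qed
  ultimately show ?thesis unfolding \<sigma>_def by blast
qed

end
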